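(* Let $M\in\mathbb{S}^{n\times n}$ be invertible with $t^*(M)=+\infty$, and suppose $(A,B)$ is controllable. Then the families of matrices $\{\Sigma_t\}_{t\in\mathbb{R}_{>0}}$ and $\{\Lambda_t\}_{t\in\mathbb{R}_{>0}}$, which are related via $\Lambda_t=\Pi^{-1}(\Xi(\Sigma_t))$, define a pair of one-parameter semigroups of matrices in $\mathbb{R}^{2n\times 2n}$ satisfying $$\Sigma_{t+s}=\Sigma_t\,\Sigma_s,\qquad \Lambda_{t+s}=\Lambda_t\circledast\Lambda_s$$ for all $t,s\in\mathbb{R}_{>0}$, in which the respective associative binary operations are standard matrix multiplication and the matrix operation $\circledast$.
   Context: $\mathbb{S}^{k\times k}$ denotes the real symmetric $k\times k$ matrices; prime denotes transpose; for $U\in\mathbb{R}^{2n\times 2n}$, $U^{ij}$ ($i,j\in\{1,2\}$) are its $n\times n$ blocks; $(\cdot)^+$ is the Moore-Penrose pseudo-inverse. Fix $A\in\mathbb{R}^{n\times n}$, $B\in\mathbb{R}^{n\times m}$, $C\in\mathbb{R}^{p\times n}$. Symplectic fundamental solution: $\Sigma_t\doteq\exp(\mathcal{H}t)$, $\mathcal{H}\doteq\begin{bmatrix}-A&-BB'\\ C'C&A'\end{bmatrix}$. For $P_0\in\mathbb{S}^{n\times n}$, $t^*(P_0)\doteq\sup\{t>0:\ \Sigma_s^{11}+\Sigma_s^{12}P_0\text{ is invertible for all }s\in(0,t]\}$. When $t^*(M)=+\infty$, let $Q_t\in\mathbb{S}^{2n\times 2n}$, $t\ge 0$, be the unique solution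 of $$\dot Q_t=\hat A'Q_t+Q_t\hat A+Q_t\hat B\hat B'Q_t+\hat C'\hat C,\qquad Q_0=\begin{bmatrix}M&-M\\-M&M\end{bmatrix},$$ with $\hat A=\begin{bmatrix}A&0\\0&0\end{bmatrix}$, $\hat B=\begin{bmatrix}B\\0\end{bmatrix}$, $\hat C=\begin{bmatrix}C&0\end{bmatrix}$ (this solution exists for all $t\ge0$). The map $\Xi$ is defined on $\{\Sigma\in\mathbb{R}^{2n\times 2n}:\Sigma^{11}+\Sigma^{12}M\text{ invertible}\}$ by $\Xi^{11}(\Sigma)=(\Sigma^{21}+\Sigma^{22}M)(\Sigma^{11}+\Sigma^{12}M)^{-1}$, $\Xi^{12}(\Sigma)=\Xi^{11}(\Sigma)\Sigma^{12}M-\Sigma^{22}M$, $\Xi^{21}(\Sigma)=-M(\Sigma^{11}+\Sigma^{12}M)^{-1}$, $\Xi^{22}(\Sigma)=\Xi^{21}(\Sigma)\Sigma^{12}M+M$. The map $\Pi^{-1}$ is defined on $\{Q\in\mathbb{S}^{2n\times 2n}:Q^{22}-M\text{ positive definite}\}$ by $$\Pi^{-1}(Q)=\begin{bmatrix}Q^{11}+Q^{12}(M-Q^{22})^{-1}(Q^{12})'&Q^{12}(M-Q^{22})^{-1}M\\ M(M-Q^{22})^{-1}(Q^{12})'&M(M-Q^{22})^{-1}M-M\end{bmatrix}.$$ Under the stated hypotheses $Q_t^{22}-M$ is positive definite for $t>0$, and $\Lambda_t\doteq\Pi^{-1}(Q_t)\in\mathbb{S}^{2n\times 2n}$ for $t>0$.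 The operation $\circledast$ on $\Lambda,\hat\Lambda\in\mathbb{S}^{2n\times 2n}$ is defined blockwise by $[\Lambda\circledast\hat\Lambda]^{11}=\Lambda^{11}-\Lambda^{12}(\hat\Lambda^{11}+\Lambda^{22})^+(\Lambda^{12})'$, $[\Lambda\circledast\hat\Lambda]^{12}=-\Lambda^{12}(\hat\Lambda^{11}+\Lambda^{22})^+\hat\Lambda^{12}$, $[\Lambda\circledast\hat\Lambda]^{21}=([\Lambda\circledast\hat\Lambda]^{12})'$, $[\Lambda\circledast\hat\Lambda]^{22}=\hat\Lambda^{22}-(\hat\Lambda^{12})'(\hat\Lambda^{11}+\Lambda^{22})^+\hat\Lambda^{12}$. *)

theory Defs
  imports "HOL-Analysis.Analysis"
begin

section \<open>Matrices and block matrices\<close>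

text \<open>
  A matrix with \<open>k\<close> rows and \<open>l\<close> columns has type \<open>real ^ 'l ^ 'k\<close>.  Matrices of size
  \<open>2n \<times> 2n\<close> are indexed by \<open>'n + 'n\<close>, with \<open>Inl\<close> for the first and \<open>Inr\<close> for the second
  block of indices.
\<close>

definition symmetric_matrix :: "real ^ 'k ^ 'k \<Rightarrow> bool" where
  "symmetric_matrix U \<longleftrightarrow> transpose U = U"

definition positive_definite :: "real ^ 'k ^ 'k \<Rightarrow> bool" where
  "positive_definite U \<longleftrightarrow> symmetric_matrix U \<and> (\<forall>x. x \<noteq> 0 \<longrightarrow> 0 < x \<bullet> (U *v x))"

definition block11 :: "real ^ ('a::finite + 'b::finite) ^ ('c::finite + 'd::finite) \<Rightarrow> real ^ 'a ^ 'c" where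
  "block11 U = (\<chi> i j. U $ Inl i $ Inl j)"

definition block12 :: "real ^ ('a::finite + 'b::finite) ^ ('c::finite + 'd::finite) \<Rightarrow> real ^ 'b ^ 'c" where
  "block12 U = (\<chi> i j. U $ Inl i $ Inr j)"

definition block21 :: "real ^ ('a::finite + 'b::finite) ^ ('c::finite + 'd::finite) \<Rightarrow> real ^ 'a ^ 'd" where
  "block21 U = (\<chi> i j. U $ Inr i $ Inl j)"

definition block22 :: "real ^ ('a::finite + 'b::finite) ^ ('c::finite + 'd::finite) \<Rightarrow> real ^ 'b ^ 'd" where
  "block22 U = (\<chi> i j. U $ Inr i $ Inr j)"

definition row_join :: "real ^ 'a ^ 'c \<Rightarrow> real ^ 'b ^ 'c \<Rightarrow> real ^ ('a + 'b) ^ 'c" where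
  "row_join U V = (\<chi> i j. case j of Inl a \<Rightarrow> U $ i $ a | Inr b \<Rightarrow> V $ i $ b)"

definition col_join :: "real ^ 'a ^ 'c \<Rightarrow> real ^ 'a ^ 'd \<Rightarrow> real ^ 'a ^ ('c + 'd)" where
  "col_join U V = (\<chi> i. case i of Inl c \<Rightarrow> U $ c | Inr d \<Rightarrow> V $ d)"

definition four_blocks ::
  "real ^ 'a ^ 'c \<Rightarrow> real ^ 'b ^ 'c \<Rightarrow> real ^ 'a ^ 'd \<Rightarrow> real ^ 'b ^ 'd \<Rightarrow> real ^ ('a + 'b) ^ ('c + 'd)" where
  "four_blocks U11 U12 U21 U22 = col_join (row_join U11 U12) (row_join U21 U22)"

text \<open>Powers must be taken with respect to \<open>**\<close>: on vectors, \<open>*\<close> is componentwise.\<close>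

definition matrix_power :: "real ^ 'k ^ 'k \<Rightarrow> nat \<Rightarrow> real ^ 'k ^ 'k" where
  "matrix_power U j = (((**) U) ^^ j) (mat 1)"

definition matrix_exp :: "real ^ 'k ^ 'k \<Rightarrow> real ^ 'k ^ 'k" where
  "matrix_exp U = (\<Sum>j. (1 / fact j) *\<^sub>R matrix_power U j)"

definition pseudo_inverse :: "real ^ 'l ^ 'k \<Rightarrow> real ^ 'k ^ 'l" where
  "pseudo_inverse U = (THE X.
     U ** X ** U = U \<and> X ** U ** X = X \<and>
     symmetric_matrix (U ** X) \<and> symmetric_matrix (X ** U))"

section \<open>Controllability\<close>

text \<open>
  Any state of \<open>\<xi>' = A \<xi> + B u\<close> can be steered to any other one in some finite time by an
  integrable control; trajectories are Caratheodory solutions, hence the integral equation.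
\<close>

definition controllable :: "real ^ 'n ^ 'n \<Rightarrow> real ^ 'm ^ 'n \<Rightarrow> bool" where
  "controllable A B \<longleftrightarrow>
     (\<forall>x y. \<exists>(T :: real) u \<xi>. 0 < T \<and> u absolutely_integrable_on {0..T} \<and>
        (\<forall>t\<in>{0..T}. ((\<lambda>s. A *v \<xi> s + B *v u s) has_integral (\<xi> t - x)) {0..t}) \<and>
        \<xi> 0 = x \<and> \<xi> T = y)"

section \<open>Symplectic fundamental solution\<close>

definition hamiltonian ::
  "real ^ 'n ^ 'n \<Rightarrow> real ^ 'm ^ 'n \<Rightarrow> real ^ 'n ^ 'p \<Rightarrow> real ^ ('n + 'n) ^ ('n + 'n)" where
  "hamiltonian A B C =
     four_blocks (- A) (- (B ** transpose B)) (transpose C ** C) (transpose A)"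

definition Sig ::
  "real ^ 'n ^ 'n \<Rightarrow> real ^ 'm ^ 'n \<Rightarrow> real ^ 'n ^ 'p \<Rightarrow> real \<Rightarrow> real ^ ('n + 'n) ^ ('n + 'n)" where
  "Sig A B C t = matrix_exp (t *\<^sub>R hamiltonian A B C)"

definition escape_time ::
  "real ^ 'n ^ 'n \<Rightarrow> real ^ 'm ^ 'n \<Rightarrow> real ^ 'n ^ 'p \<Rightarrow> real ^ 'n ^ 'n \<Rightarrow> ereal" where
  "escape_time A B C P0 = Sup {ereal t | t. 0 < t \<and>
     (\<forall>s\<in>{0<..t}. invertible (block11 (Sig A B C s) + block12 (Sig A B C s) ** P0))}"

section \<open>The Riccati equation for Q\<close>

definition riccati_solution ::
  "real ^ 'n ^ 'n \<Rightarrow> real ^ 'm ^ 'n \<Rightarrow> real ^ 'n ^ 'p \<Rightarrow> real ^ 'n ^ 'n \<Rightarrow>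
   (real \<Rightarrow> real ^ ('n + 'n) ^ ('n + 'n)) \<Rightarrow> bool" where
  "riccati_solution A B C M Q \<longleftrightarrow>
     (let Ah = four_blocks A 0 0 0 :: real ^ ('n + 'n) ^ ('n + 'n);
          Bh = col_join B 0 :: real ^ 'm ^ ('n + 'n);
          Ch = row_join C 0 :: real ^ ('n + 'n) ^ 'p
      in Q 0 = four_blocks M (- M) (- M) M \<and>
         (\<forall>t\<ge>0. symmetric_matrix (Q t) \<and>
            (Q has_vector_derivative
              (transpose Ah ** Q t + Q t ** Ah + Q t ** Bh ** transpose Bh ** Q t
                + transpose Ch ** Ch)) (at t within {0..})))"

text \<open>The value at \<open>t \<ge> 0\<close> of the unique solution on \<open>{0..}\<close>.\<close>

definition riccati ::
  "real ^ 'n ^ 'n \<Rightarrow> real ^ 'm ^ 'n \<Rightarrow> real ^ 'n ^ 'p \<Rightarrow> real ^ 'n ^ 'n \<Rightarrow>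
   real \<Rightarrow> real ^ ('n + 'n) ^ ('n + 'n)" where
  "riccati A B C M t = (THE X. \<exists>Q. riccati_solution A B C M Q \<and> Q t = X)"

section \<open>The maps relating the representations\<close>

text \<open>
  \<open>Xi\<close> and \<open>Pi_inv\<close> are total functions whose values are meaningful only on
  \<open>Xi_domain\<close> and \<open>Pi_inv_domain\<close>.
\<close>

definition Xi_domain :: "real ^ 'n ^ 'n \<Rightarrow> (real ^ ('n + 'n) ^ ('n + 'n)) set" where
  "Xi_domain M = {S. invertible (block11 S + block12 S ** M)}"

definition Xi ::
  "real ^ 'n ^ 'n \<Rightarrow> real ^ ('n + 'n) ^ ('n + 'n) \<Rightarrow> real ^ ('n + 'n) ^ ('n + 'n)" where
  "Xi M S =
     (let X = matrix_inv (block11 S + block12 S ** M);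
          X11 = (block21 S + block22 S ** M) ** X;
          X21 = - (M ** X)
      in four_blocks X11 (X11 ** block12 S ** M - block22 S ** M)
                     X21 (X21 ** block12 S ** M + M))"

definition Pi_inv_domain :: "real ^ 'n ^ 'n \<Rightarrow> (real ^ ('n + 'n) ^ ('n + 'n)) set" where
  "Pi_inv_domain M = {Q. symmetric_matrix Q \<and> positive_definite (block22 Q - M)}"

definition Pi_inv ::
  "real ^ 'n ^ 'n \<Rightarrow> real ^ ('n + 'n) ^ ('n + 'n) \<Rightarrow> real ^ ('n + 'n) ^ ('n + 'n)" where
  "Pi_inv M Q =
     (let R = matrix_inv (M - block22 Q)
      in four_blocks
           (block11 Q + block12 Q ** R ** transpose (block12 Q)) (block12 Q ** R ** M)
           (M ** R ** transpose (block12 Q))                     (M ** R ** M - M))"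

definition Lam ::
  "real ^ 'n ^ 'n \<Rightarrow> real ^ 'm ^ 'n \<Rightarrow> real ^ 'n ^ 'p \<Rightarrow> real ^ 'n ^ 'n \<Rightarrow>
   real \<Rightarrow> real ^ ('n + 'n) ^ ('n + 'n)" where
  "Lam A B C M t = Pi_inv M (riccati A B C M t)"

section \<open>Semigroup operations\<close>

definition circledast ::
  "real ^ ('n::finite + 'n) ^ ('n + 'n) \<Rightarrow> real ^ ('n + 'n) ^ ('n + 'n) \<Rightarrow> real ^ ('n + 'n) ^ ('n + 'n)"
  (infixl "\<circledast>" 70) where
  "L \<circledast> K =
     (let P = pseudo_inverse (block11 K + block22 L);
          N12 = - (block12 L ** P ** block12 K)
      in four_blocks
           (block11 L - block12 L ** P ** transpose (block12 L)) N12
           (transpose N12) (block22 K - transpose (block12 K) ** P ** block12 K))"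

text \<open>
  Associativity is required on the family only: \<open>\<circledast>\<close> is not associative on arbitrary
  symmetric matrices.  For scalar blocks, with entries listed as (11, 12, 22), the triples
  (0, 1, 0), (0, 1, 0), (1, 1, 0) are a counterexample.
\<close>

definition one_parameter_semigroup :: "('a \<Rightarrow> 'a \<Rightarrow> 'a) \<Rightarrow> (real \<Rightarrow> 'a) \<Rightarrow> bool" where
  "one_parameter_semigroup f F \<longleftrightarrow>
     (\<forall>t>0. \<forall>s>0. F (t + s) = f (F t) (F s)) \<and>
     (\<forall>x\<in>F ` {0<..}. \<forall>y\<in>F ` {0<..}. \<forall>z\<in>F ` {0<..}. f (f x y) z = f x (f y z))"

end

theory Submission
  imports Defs
begin

text \<open>
  Write \<open>a, b, c, d\<close> for the blocks of \<open>\<Sigma>\<^sub>t\<close>, which maps \<open>(u\<^sub>0, v\<^sub>0)\<close> to \<open>(u\<^sub>1, v\<^sub>1)\<close>.  When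
  \<open>b\<close> is invertible, this graph can be parametrised by the two boundary values \<open>u\<^sub>1\<close> and \<open>u\<^sub>0\<close>:
  solving for the remaining two unknowns gives \<open>(v\<^sub>1, - v\<^sub>0) = \<Lambda> (u\<^sub>1, u\<^sub>0)\<close>, where \<open>\<Lambda>\<close> has the
  blocks \<open>d b\<^sup>-\<^sup>1\<close>, \<open>- b\<^sup>-\<^sup>T\<close>, \<open>- b\<^sup>-\<^sup>1\<close> and \<open>b\<^sup>-\<^sup>1 a\<close> (\<open>scattering\<close> below); the relations
  expressing that \<open>\<Sigma>\<^sub>t\<close> is symplectic make it symmetric.  The heart of the proof is that
  \<open>\<Lambda>\<^sub>t = \<Pi>\<^sup>-\<^sup>1 (\<Xi> (\<Sigma>\<^sub>t))\<close> is exactly this matrix, so that the auxiliary matrix \<open>M\<close> cancels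
  (\<open>Pi_inv_Xi_eq_scattering\<close>).

  Composing two such graphs means identifying the end point \<open>w\<close> of the first with the starting
  point of the second and eliminating it from the matching condition for \<open>v\<close>, whose
  coefficient matrix is \<open>\<Lambda>\<^sub>s\<^sup>1\<^sup>1 + \<Lambda>\<^sub>t\<^sup>2\<^sup>2\<close>.  The Schur complement obtained this way is the operation
  \<open>\<circledast>\<close>, and the coefficient factors as \<open>b\<^sub>t\<^sup>-\<^sup>1 b\<^sub>t\<^sub>+\<^sub>s b\<^sub>s\<^sup>-\<^sup>1\<close>, so it is invertible and the
  pseudo-inverse in \<open>\<circledast>\<close> is the inverse (\<open>circledast_scattering\<close>).  The law
  \<open>\<Lambda>\<^sub>t\<^sub>+\<^sub>s = \<Lambda>\<^sub>t \<circledast> \<Lambda>\<^sub>s\<close> is thus the law for \<open>\<Sigma>\<close> in other coordinates, and associativity on each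
  family is inherited from the addition of times.

  Two analytic facts remain.  First, \<open>\<Xi> (\<Sigma>\<^sub>t)\<close> is the solution \<open>Q\<^sub>t\<close> of the Riccati equation: it
  satisfies the equation by the linear Hamiltonian equation for \<open>\<Sigma>\<close>, and solutions are unique
  because the difference of two of them solves a linear equation (\<open>riccati_eq_Xi\<close>).  Second,
  \<open>Q\<^sub>t\<^sup>2\<^sup>2 - M\<close> is positive definite for \<open>t > 0\<close> (\<open>block22_Xi_positive\<close>), which also makes \<open>b\<close>
  invertible.  Its quadratic form at \<open>x\<close> is the integral of \<open>|B' y|\<^sup>2\<close> with \<open>y = Q\<^sup>1\<^sup>2 x\<close>; if it
  vanished, \<open>y\<close> would solve \<open>y' = A' y\<close> inside the kernel of \<open>B'\<close>, and no trajectory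
  starting at \<open>0\<close> could acquire a component along \<open>y 0 = - M x\<close>.
\<close>

section \<open>Matrix algebra and block matrices\<close>

lemma bounded_bilinear_matrix_mult:
  "bounded_bilinear ((**) :: real^'n^'m \<Rightarrow> real^'k^'n \<Rightarrow> real^'k^'m)"
proof -
  have "bilinear ((**) :: real^'n^'m \<Rightarrow> real^'k^'n \<Rightarrow> real^'k^'m)"
    unfolding bilinear_def
    by (auto intro!: linearI simp: vec_eq_iff matrix_matrix_mult_def algebra_simps
        sum.distrib sum_distrib_left)
  then show ?thesis
    by (simp add: bilinear_conv_bounded_bilinear)
qed

lemma bounded_bilinear_matrix_vector_mult:
  "bounded_bilinear ((*v) :: real^'n^'m \<Rightarrow> real^'n \<Rightarrow> real^'m)"
proof -
  have "bilinear ((*v) :: real^'n^'m \<Rightarrow> real^'n \<Rightarrow> real^'m)"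
    unfolding bilinear_def
    by (auto intro!: linearI simp: vec_eq_iff matrix_vector_mult_def algebra_simps
        sum.distrib sum_distrib_left)
  then show ?thesis
    by (simp add: bilinear_conv_bounded_bilinear)
qed

lemma bounded_linear_transpose:
  "bounded_linear (transpose :: real^'n^'m \<Rightarrow> real^'m^'n)"
  unfolding linear_conv_bounded_linear[symmetric]
  by (auto intro!: linearI simp: vec_eq_iff transpose_def)

lemma bounded_linear_blocks:
  "bounded_linear (block11 :: real^('a::finite+'b::finite)^('c::finite+'d::finite) \<Rightarrow> _)"
  "bounded_linear (block12 :: real^('a::finite+'b::finite)^('c::finite+'d::finite) \<Rightarrow> _)"
  "bounded_linear (block21 :: real^('a::finite+'b::finite)^('c::finite+'d::finite) \<Rightarrow> _)"
  "bounded_linear (block22 :: real^('a::finite+'b::finite)^('c::finite+'d::finite) \<Rightarrow> _)"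
  unfolding linear_conv_bounded_linear[symmetric]
  by (auto intro!: linearI simp: vec_eq_iff block11_def block12_def block21_def block22_def)

text \<open>
  Products are normalised to left-nested sums of monomials.  For cancellations, facts about an
  inverse \<open>X\<close> of \<open>Y\<close> are therefore also supplied in the form \<open>Z ** Y ** X = Z\<close>.
\<close>

lemmas matrix_distrib =
  bounded_bilinear.add_left[OF bounded_bilinear_matrix_mult]
  bounded_bilinear.add_right[OF bounded_bilinear_matrix_mult]
  bounded_bilinear.diff_left[OF bounded_bilinear_matrix_mult]
  bounded_bilinear.diff_right[OF bounded_bilinear_matrix_mult]
  bounded_bilinear.minus_left[OF bounded_bilinear_matrix_mult]
  bounded_bilinear.minus_right[OF bounded_bilinear_matrix_mult]
  matrix_mul_assoc

lemmas matrix_zero [simp] =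
  bounded_bilinear.zero_left[OF bounded_bilinear_matrix_mult]
  bounded_bilinear.zero_right[OF bounded_bilinear_matrix_mult]

lemmas transpose_distrib =
  linear_add[OF bounded_linear.linear[OF bounded_linear_transpose]]
  linear_diff[OF bounded_linear.linear[OF bounded_linear_transpose]]
  linear_neg[OF bounded_linear.linear[OF bounded_linear_transpose]]
  matrix_transpose_mul

lemmas transpose_zero [simp] = linear_0[OF bounded_linear.linear[OF bounded_linear_transpose]]

lemmas has_vector_derivative_matrix_mult =
  bounded_bilinear.has_vector_derivative[OF bounded_bilinear_matrix_mult]

lemmas has_vector_derivative_transpose =
  bounded_linear.has_vector_derivative[OF bounded_linear_transpose]

lemma blocks_four_blocks [simp]:
  "block11 (four_blocks P Q R S) = P" "block12 (four_blocks P Q R S) = Q"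
  "block21 (four_blocks P Q R S) = R" "block22 (four_blocks P Q R S) = S"
  by (simp_all add: vec_eq_iff block11_def block12_def block21_def block22_def
      four_blocks_def col_join_def row_join_def)

lemma four_blocks_blocks: "four_blocks (block11 U) (block12 U) (block21 U) (block22 U) = U"
  by (auto simp: vec_eq_iff block11_def block12_def block21_def block22_def
      four_blocks_def col_join_def row_join_def split: sum.split)

lemma blocks_eqI:
  assumes "block11 U = block11 V" "block12 U = block12 V"
    "block21 U = block21 V" "block22 U = block22 V"
  shows "U = V"
  by (metis assms four_blocks_blocks)

lemma sum_UNIV_Plus:
  "(\<Sum>x\<in>(UNIV :: ('a::finite + 'b::finite) set). f x) = (\<Sum>a\<in>UNIV. f (Inl a)) + (\<Sum>b\<in>UNIV. f (Inr b))"
  unfolding UNIV_Plus_UNIV[symmetric] by (subst sum.Plus) auto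

lemma blocks_mult:
  "block11 (U ** V) = block11 U ** block11 V + block12 U ** block21 V"
  "block12 (U ** V) = block11 U ** block12 V + block12 U ** block22 V"
  "block21 (U ** V) = block21 U ** block11 V + block22 U ** block21 V"
  "block22 (U ** V) = block21 U ** block12 V + block22 U ** block22 V"
  by (simp_all add: vec_eq_iff block11_def block12_def block21_def block22_def
      matrix_matrix_mult_def sum_UNIV_Plus)

lemma blocks_transpose:
  "block11 (transpose U) = transpose (block11 U)" "block12 (transpose U) = transpose (block21 U)"
  "block21 (transpose U) = transpose (block12 U)" "block22 (transpose U) = transpose (block22 U)"
  by (simp_all add: vec_eq_iff block11_def block12_def block21_def block22_def transpose_def)

lemma blocks_add:
  "block11 (U + V) = block11 U + block11 V" "block12 (U + V) = block12 U + block12 V"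
  "block21 (U + V) = block21 U + block21 V" "block22 (U + V) = block22 U + block22 V"
  by (simp_all add: vec_eq_iff block11_def block12_def block21_def block22_def)

lemma blocks_mat_1:
  "block11 (mat 1 :: real^('n::finite+'n)^('n+'n)) = mat 1" "block12 (mat 1 :: real^('n::finite+'n)^('n+'n)) = 0"
  "block21 (mat 1 :: real^('n::finite+'n)^('n+'n)) = 0" "block22 (mat 1 :: real^('n::finite+'n)^('n+'n)) = mat 1"
  by (simp_all add: vec_eq_iff block11_def block12_def block21_def block22_def mat_def)

lemma row_col_join_mult:
  "transpose (row_join P Q) ** row_join P' Q' = four_blocks (transpose P ** P') (transpose P ** Q') (transpose Q ** P') (transpose Q ** Q')"
  "col_join P R ** transpose (col_join P' R') = four_blocks (P ** transpose P') (P ** transpose R') (R ** transpose P') (R ** transpose R')"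
  by (auto simp: vec_eq_iff matrix_matrix_mult_def transpose_def
      four_blocks_def col_join_def row_join_def split: sum.split)

lemma matrix_mult_norm_bound:
  obtains K where "K \<ge> 0"
    "\<And>(X :: real^'n^'m) (Y :: real^'k^'n). norm (X ** Y) \<le> K * norm X * norm Y"
  using bounded_bilinear.nonneg_bounded[OF bounded_bilinear_matrix_mult]
  by (metis mult.commute mult.left_commute)

lemma four_blocks_mult:
  "four_blocks P Q R S ** four_blocks P' Q' R' S' =
    four_blocks (P ** P' + Q ** R') (P ** Q' + Q ** S') (R ** P' + S ** R') (R ** Q' + S ** S')"
  by (rule blocks_eqI) (simp_all add: blocks_mult)

lemma four_blocks_add:
  "four_blocks P Q R S + four_blocks P' Q' R' S' = four_blocks (P + P') (Q + Q') (R + R') (S + S')"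
  by (rule blocks_eqI) (simp_all add: blocks_add)

lemma transpose_four_blocks:
  "transpose (four_blocks P Q R S) = four_blocks (transpose P) (transpose R) (transpose Q) (transpose S)"
  by (rule blocks_eqI) (simp_all add: blocks_transpose)

lemma has_vector_derivative_four_blocks:
  fixes P :: "real \<Rightarrow> real^'a^'c" and Q :: "real \<Rightarrow> real^'b^'c"
    and R :: "real \<Rightarrow> real^'a^'d" and S :: "real \<Rightarrow> real^'b^'d"
  assumes "(P has_vector_derivative P') (at x within X)" "(Q has_vector_derivative Q') (at x within X)"
    "(R has_vector_derivative R') (at x within X)" "(S has_vector_derivative S') (at x within X)"
  shows "((\<lambda>t. four_blocks (P t) (Q t) (R t) (S t)) has_vector_derivative four_blocks P' Q' R' S') (at x within X)"
proof -
  have "bounded_linear (\<lambda>(P :: real^'a^'c, Q :: real^'b^'c, R :: real^'a^'d, S :: real^'b^'d). four_blocks P Q R S)"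
    unfolding linear_conv_bounded_linear[symmetric]
    by (auto intro!: linearI simp: vec_eq_iff four_blocks_def col_join_def row_join_def split: sum.split)
  from bounded_linear.has_vector_derivative[OF this has_vector_derivative_Pair[OF assms(1)
        has_vector_derivative_Pair[OF assms(2) has_vector_derivative_Pair[OF assms(3,4)]]]]
  show ?thesis by simp
qed

section \<open>Inverses and pseudo-inverses\<close>

lemma matrix_inv_works:
  fixes U :: "real^'n^'n"
  assumes "invertible U"
  shows "U ** matrix_inv U = mat 1" "matrix_inv U ** U = mat 1"
proof -
  have "U ** matrix_inv U = mat 1 \<and> matrix_inv U ** U = mat 1"
    using assms unfolding invertible_def matrix_inv_def by (rule someI_ex)
  then show "U ** matrix_inv U = mat 1" "matrix_inv U ** U = mat 1" by auto
qed

lemma matrix_inv_eqI: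
  fixes U X :: "real^'n^'n"
  assumes "U ** X = mat 1"
  shows "invertible U" "matrix_inv U = X"
proof -
  show *: "invertible U"
    using assms matrix_left_right_inverse unfolding invertible_def by blast
  show "matrix_inv U = X"
    by (metis assms matrix_inv_works(2)[OF *] matrix_mul_assoc matrix_mul_lid matrix_mul_rid)
qed

text \<open>
  Cancelling the invertible \<open>U\<close> in the first Penrose equation leaves \<open>U ** X = mat 1\<close>.
\<close>

lemma pseudo_inverse_invertible:
  fixes U :: "real^'n^'n"
  assumes "invertible U"
  shows "pseudo_inverse U = matrix_inv U"
  unfolding pseudo_inverse_def
proof (rule the_equality)
  show "U ** matrix_inv U ** U = U \<and> matrix_inv U ** U ** matrix_inv U = matrix_inv U \<and>
     symmetric_matrix (U ** matrix_inv U) \<and> symmetric_matrix (matrix_inv U ** U)"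
    by (simp add: matrix_inv_works[OF assms] symmetric_matrix_def)
next
  fix X
  assume "U ** X ** U = U \<and> X ** U ** X = X \<and>
     symmetric_matrix (U ** X) \<and> symmetric_matrix (X ** U)"
  then have "U ** X ** U ** matrix_inv U = mat 1"
    by (simp add: matrix_inv_works[OF assms])
  then have "U ** X = mat 1"
    by (metis matrix_inv_works(1)[OF assms] matrix_mul_assoc matrix_mul_rid)
  then show "X = matrix_inv U"
    by (simp add: matrix_inv_eqI)
qed

lemma matrix_inv_left_right:
  fixes U :: "real^'n^'n"
  assumes "invertible U"
  shows "U ** matrix_inv U = mat 1" "matrix_inv U ** U = mat 1"
    "Z ** U ** matrix_inv U = Z" "Z ** matrix_inv U ** U = Z"
  by (simp_all add: matrix_inv_works[OF assms] matrix_mul_assoc[symmetric])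

lemma symmetric_matrix_inv:
  fixes U :: "real^'n^'n"
  assumes "invertible U" "transpose U = U"
  shows "transpose (matrix_inv U) = matrix_inv U"
proof -
  have "U ** transpose (matrix_inv U) = transpose (matrix_inv U ** U)"
    by (simp add: matrix_transpose_mul assms(2))
  also have "\<dots> = mat 1"
    by (simp add: matrix_inv_works[OF assms(1)])
  finally show ?thesis
    using matrix_inv_eqI by metis
qed

lemma has_vector_derivative_iff_quotient:
  fixes f :: "real \<Rightarrow> 'a::real_normed_vector"
  shows "(f has_vector_derivative f') (at t within S) \<longleftrightarrow>
    ((\<lambda>s. (f s - f t) /\<^sub>R (s - t)) \<longlongrightarrow> f') (at t within S)"
proof -
  have "(f has_vector_derivative f') (at t within S) \<longleftrightarrow>
      ((\<lambda>s. norm (f s - f t - (s - t) *\<^sub>R f') / norm (s - t)) \<longlongrightarrow> 0) (at t within S)"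
    by (simp add: has_vector_derivative_def has_derivative_iff_norm bounded_linear_scaleR_left)
  also have "\<dots> \<longleftrightarrow> ((\<lambda>s. norm ((f s - f t) /\<^sub>R (s - t) - f')) \<longlongrightarrow> 0) (at t within S)"
  proof (rule tendsto_cong)
    have "norm (f s - f t - (s - t) *\<^sub>R f') / norm (s - t) = norm ((f s - f t) /\<^sub>R (s - t) - f')"
      if "s \<noteq> t" for s
    proof -
      have "(f s - f t) /\<^sub>R (s - t) - f' = (f s - f t - (s - t) *\<^sub>R f') /\<^sub>R (s - t)"
        using that by (simp add: scaleR_diff_right)
      then show ?thesis
        by (simp add: divide_inverse abs_inverse mult.commute)
    qed
    then show "\<forall>\<^sub>F s in at t within S.
        norm (f s - f t - (s - t) *\<^sub>R f') / norm (s - t) = norm ((f s - f t) /\<^sub>R (s - t) - f')"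
      by (auto simp: eventually_at_filter)
  qed
  also have "\<dots> \<longleftrightarrow> ((\<lambda>s. (f s - f t) /\<^sub>R (s - t)) \<longlongrightarrow> f') (at t within S)"
    by (simp add: tendsto_norm_zero_iff LIM_zero_iff)
  finally show ?thesis .
qed

text \<open>
  Everything follows from \<open>N s - N t = - N s (U s - U t) N t\<close> for \<open>N = U\<^sup>-\<^sup>1\<close>: it bounds \<open>N s\<close> near
  \<open>t\<close>, hence gives continuity of \<open>N\<close>, and then the limit of the difference quotient.
\<close>

lemma has_vector_derivative_matrix_inv:
  fixes U :: "real \<Rightarrow> real^'n^'n"
  assumes U: "(U has_vector_derivative U') (at t within S)"
    and inv: "\<And>s. s \<in> S \<Longrightarrow> invertible (U s)" and t: "t \<in> S"
  shows "((\<lambda>s. matrix_inv (U s)) has_vector_derivative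
    - (matrix_inv (U t) ** U' ** matrix_inv (U t))) (at t within S)"
proof -
  define N where "N = (\<lambda>s. matrix_inv (U s))"
  have diff: "N s - N t = - (N s ** (U s - U t) ** N t)" if "s \<in> S" for s
    using matrix_inv_works[OF inv[OF that]] matrix_inv_works[OF inv[OF t]]
    by (simp add: matrix_distrib N_def matrix_mul_assoc[symmetric])
  obtain K where K: "K \<ge> 0"
    "\<And>(X :: real^'n^'n) (Y :: real^'n^'n). norm (X ** Y) \<le> K * norm X * norm Y"
    using matrix_mult_norm_bound by blast
  have U_lim: "(U \<longlongrightarrow> U t) (at t within S)"
    using has_vector_derivative_continuous[OF U] by (simp add: continuous_within)
  define \<epsilon> where "\<epsilon> = (\<lambda>s. K * K * norm (N t) * norm (U s - U t))"
  have \<epsilon>_lim: "(\<epsilon> \<longlongrightarrow> 0) (at t within S)"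
    using tendsto_mult_right_zero[OF tendsto_norm_zero[OF LIM_zero[OF U_lim]]]
    by (simp add: \<epsilon>_def)
  have N_diff: "norm (N s - N t) \<le> norm (N s) * \<epsilon> s" if "s \<in> S" for s
  proof -
    have "norm (N s - N t) \<le> K * norm (N s ** (U s - U t)) * norm (N t)"
      unfolding diff[OF that] norm_minus_cancel by (rule K)
    also have "\<dots> \<le> K * (K * norm (N s) * norm (U s - U t)) * norm (N t)"
      using K by (intro mult_right_mono mult_left_mono) auto
    finally show ?thesis by (simp add: \<epsilon>_def mult_ac)
  qed
  have "\<forall>\<^sub>F s in at t within S. norm (N s - N t) \<le> \<epsilon> s * (2 * norm (N t))"
  proof -
    have "\<forall>\<^sub>F s in at t within S. \<epsilon> s < 1 / 2"
      by (rule order_tendstoD[OF \<epsilon>_lim]) simp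
    moreover have "\<forall>\<^sub>F s in at t within S. s \<in> S"
      by (auto simp: eventually_at_filter)
    ultimately show ?thesis
    proof eventually_elim
      case (elim s)
      have "norm (N s) \<le> norm (N t) + norm (N s - N t)"
        using norm_triangle_sub by blast
      also have "norm (N s - N t) \<le> norm (N s) * (1 / 2)"
        using N_diff[OF elim(2)] elim(1) mult_left_mono[of "\<epsilon> s" "1 / 2" "norm (N s)"] by simp
      finally have "norm (N s) \<le> 2 * norm (N t)" by simp
      then have "norm (N s) * \<epsilon> s \<le> 2 * norm (N t) * \<epsilon> s"
        by (rule mult_right_mono) (use K(1) in \<open>simp add: \<epsilon>_def\<close>)
      then show ?case using N_diff[OF elim(2)] by (simp add: mult_ac)
    qed
  qed
  then have "((\<lambda>s. N s - N t) \<longlongrightarrow> 0) (at t within S)"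
    using \<epsilon>_lim by (rule Lim_null_comparison[OF _ tendsto_mult_left_zero])
  then have N_lim: "(N \<longlongrightarrow> N t) (at t within S)"
    by (rule LIM_zero_cancel)
  have "((\<lambda>s. - (N s ** ((U s - U t) /\<^sub>R (s - t)) ** N t)) \<longlongrightarrow> - (N t ** U' ** N t)) (at t within S)"
    using U N_lim unfolding has_vector_derivative_iff_quotient
    by (intro tendsto_minus bounded_bilinear.tendsto[OF bounded_bilinear_matrix_mult] tendsto_const)
  moreover have "\<forall>\<^sub>F s in at t within S.
      - (N s ** ((U s - U t) /\<^sub>R (s - t)) ** N t) = (N s - N t) /\<^sub>R (s - t)"
    unfolding eventually_at_filter
    by (rule always_eventually)
      (auto simp: diff bounded_bilinear.scaleR_left[OF bounded_bilinear_matrix_mult]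
        bounded_bilinear.scaleR_right[OF bounded_bilinear_matrix_mult])
  ultimately have "((\<lambda>s. (N s - N t) /\<^sub>R (s - t)) \<longlongrightarrow> - (N t ** U' ** N t)) (at t within S)"
    by (rule Lim_transform_eventually)
  then show ?thesis
    unfolding has_vector_derivative_iff_quotient N_def .
qed

section \<open>Linear differential equations and the matrix exponential\<close>

text \<open>
  A Gronwall argument: \<open>exp (- 2 K t) |D t|\<^sup>2\<close> has a nonpositive derivative.
\<close>

lemma eq_0_if_derivative_norm_le:
  fixes D :: "real \<Rightarrow> 'a::real_inner"
  assumes D: "\<And>t. t \<in> {0..T} \<Longrightarrow> (D has_vector_derivative D' t) (at t within {0..T})"
    and le: "\<And>t. t \<in> {0..T} \<Longrightarrow> norm (D' t) \<le> K * norm (D t)"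
    and D0: "D 0 = 0" and t: "t \<in> {0..T}"
  shows "D t = 0"
proof -
  define e where "e = (\<lambda>s. exp (- 2 * K * s) * (D s \<bullet> D s))"
  have cont: "continuous_on {0..t} D"
    using D t by (intro continuous_on_subset[OF continuous_on_vector_derivative, of "{0..T}"]) auto
  have "e 0 \<ge> e t"
  proof (rule DERIV_nonpos_imp_decreasing_open[where f = e and a = 0 and b = t])
    fix s assume s: "0 < s" "s < t"
    then have "(D has_vector_derivative D' s) (at s)"
      using D[of s] t at_within_interior[of s "{0..T}"] by auto
    then have "((\<lambda>s. D s \<bullet> D s) has_real_derivative 2 * (D s \<bullet> D' s)) (at s)"
      by (auto simp: has_vector_derivative_def has_field_derivative_def inner_commute
          intro!: derivative_eq_intros)
    then have "(e has_real_derivative exp (- 2 * K * s) * (2 * (D s \<bullet> D' s) - 2 * K * (D s \<bullet> D s))) (at s)"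
      unfolding e_def by (auto intro!: derivative_eq_intros simp: algebra_simps)
    moreover have "D s \<bullet> D' s \<le> K * (D s \<bullet> D s)"
    proof -
      have "D s \<bullet> D' s \<le> norm (D s) * norm (D' s)" by (rule norm_cauchy_schwarz)
      also have "\<dots> \<le> norm (D s) * (K * norm (D s))"
        using le[of s] s t by (intro mult_left_mono) auto
      finally show ?thesis by (simp add: power2_norm_eq_inner[symmetric] power2_eq_square algebra_simps)
    qed
    ultimately show "\<exists>y. DERIV e s :> y \<and> y \<le> 0"
      by (intro exI[of _ "exp (- 2 * K * s) * (2 * (D s \<bullet> D' s) - 2 * K * (D s \<bullet> D s))"] conjI)
        (auto intro!: mult_nonneg_nonpos)
  qed (use t cont in \<open>auto simp: e_def intro!: continuous_intros\<close>)
  then have "D t \<bullet> D t \<le> 0"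
    by (simp add: e_def D0 mult_le_0_iff)
  then show ?thesis by (metis inner_ge_zero inner_eq_zero_iff order_antisym)
qed

text \<open>
  The two-sided form covers both uses: the composition law of the flow (\<open>L = 0\<close>), and the difference
  of two solutions of a Riccati equation.
\<close>

lemma linear_matrix_ode_eq_0:
  fixes D :: "real \<Rightarrow> real^'n^'m"
  assumes D: "\<And>t. t \<in> {0..T} \<Longrightarrow>
      (D has_vector_derivative F t ** D t + D t ** L t) (at t within {0..T})"
    and F: "continuous_on {0..T} F" and L: "continuous_on {0..T} L"
    and D0: "D 0 = 0" and t: "t \<in> {0..T}"
  shows "D t = 0"
proof -
  obtain f where f: "\<And>t. t \<in> {0..T} \<Longrightarrow> norm (F t) \<le> f"
    using compact_imp_bounded[OF compact_continuous_image[OF F compact_Icc]]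
    unfolding bounded_iff by (metis image_eqI)
  obtain l where l: "\<And>t. t \<in> {0..T} \<Longrightarrow> norm (L t) \<le> l"
    using compact_imp_bounded[OF compact_continuous_image[OF L compact_Icc]]
    unfolding bounded_iff by (metis image_eqI)
  obtain K where K: "K \<ge> 0"
    "\<And>(X :: real^'m^'m) (Y :: real^'n^'m). norm (X ** Y) \<le> K * norm X * norm Y"
    using matrix_mult_norm_bound by blast
  obtain K' where K': "K' \<ge> 0"
    "\<And>(X :: real^'n^'m) (Y :: real^'n^'n). norm (X ** Y) \<le> K' * norm X * norm Y"
    using matrix_mult_norm_bound by blast
  show ?thesis
  proof (rule eq_0_if_derivative_norm_le[OF D _ D0 t, of "K * f + K' * l"])
    fix s assume s: "s \<in> {0..T}"
    have "norm (F s ** D s + D s ** L s) \<le> K * norm (F s) * norm (D s) + K' * norm (D s) * norm (L s)"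
      by (intro norm_triangle_le add_mono K K')
    also have "\<dots> \<le> K * f * norm (D s) + K' * norm (D s) * l"
      using K K' f[OF s] l[OF s] by (intro add_mono mult_right_mono mult_left_mono mult_nonneg_nonneg) auto
    finally show "norm (F s ** D s + D s ** L s) \<le> (K * f + K' * l) * norm (D s)"
      by (simp add: algebra_simps)
  qed
qed

lemma matrix_power_scaleR: "matrix_power (t *\<^sub>R U) j = t ^ j *\<^sub>R matrix_power U j"
  by (induction j)
    (simp_all add: matrix_power_def bounded_bilinear.scaleR_left[OF bounded_bilinear_matrix_mult]
      bounded_bilinear.scaleR_right[OF bounded_bilinear_matrix_mult])

lemma matrix_power_Suc: "matrix_power U (Suc j) = U ** matrix_power U j"
  by (simp add: matrix_power_def)

lemma norm_matrix_power_le: 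
  fixes U :: "real^'n^'n"
  shows "\<exists>r. \<forall>j. norm (matrix_power U j) \<le> norm (mat 1 :: real^'n^'n) * r ^ j"
proof -
  obtain K where K: "K \<ge> 0"
    "\<And>(X :: real^'n^'n) (Y :: real^'n^'n). norm (X ** Y) \<le> K * norm X * norm Y"
    using matrix_mult_norm_bound by blast
  have "norm (matrix_power U j) \<le> norm (mat 1 :: real^'n^'n) * (norm U * K) ^ j" for j
  proof (induction j)
    case 0
    then show ?case by (simp add: matrix_power_def)
  next
    case (Suc j)
    have "norm (matrix_power U (Suc j)) \<le> (norm U * K) * norm (matrix_power U j)"
      unfolding matrix_power_Suc using K(2)[of U "matrix_power U j"] by (simp add: mult_ac)
    also have "\<dots> \<le> (norm U * K) * (norm (mat 1 :: real^'n^'n) * (norm U * K) ^ j)"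
      using K(1) Suc by (intro mult_left_mono) auto
    finally show ?case by (simp add: mult_ac)
  qed
  then show ?thesis by blast
qed

lemma summable_matrix_exp:
  fixes U :: "real^'n^'n"
  shows "summable (\<lambda>j. (y ^ j / fact j) *\<^sub>R matrix_power U j)"
proof -
  obtain r where r: "\<And>j. norm (matrix_power U j) \<le> norm (mat 1 :: real^'n^'n) * r ^ j"
    using norm_matrix_power_le by blast
  have "summable (\<lambda>j. norm (mat 1 :: real^'n^'n) * (inverse (fact j) * (r * \<bar>y\<bar>) ^ j))"
    by (intro summable_mult summable_exp)
  then show ?thesis
  proof (rule summable_comparison_test'[where N = 0])
    fix j :: nat
    have "norm ((y ^ j / fact j) *\<^sub>R matrix_power U j) = \<bar>y\<bar> ^ j / fact j * norm (matrix_power U j)"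
      by (simp add: power_abs)
    also have "\<dots> \<le> \<bar>y\<bar> ^ j / fact j * (norm (mat 1 :: real^'n^'n) * r ^ j)"
      by (intro mult_left_mono r) auto
    finally show "norm ((y ^ j / fact j) *\<^sub>R matrix_power U j)
        \<le> norm (mat 1 :: real^'n^'n) * (inverse (fact j) * (r * \<bar>y\<bar>) ^ j)"
      by (simp add: field_simps)
  qed
qed

lemma matrix_exp_eq: "matrix_exp (t *\<^sub>R U) = (\<Sum>j. (t ^ j / fact j) *\<^sub>R matrix_power U j)"
  by (simp add: matrix_exp_def matrix_power_scaleR)

text \<open>
  Each component with respect to a basis is a real power series with infinite radius of
  convergence, so it can be differentiated termwise.
\<close>

lemma matrix_exp_has_vector_derivative:
  fixes U :: "real^'n^'n"
  shows "((\<lambda>t. matrix_exp (t *\<^sub>R U)) has_vector_derivative U ** matrix_exp (t *\<^sub>R U)) (at t within S)"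
proof -
  have "((\<lambda>t. matrix_exp (t *\<^sub>R U) \<bullet> b) has_derivative
      (\<lambda>h. (h *\<^sub>R (U ** matrix_exp (t *\<^sub>R U))) \<bullet> b)) (at t)" for b
  proof -
    define c where "c = (\<lambda>j. (matrix_power U j \<bullet> b) / fact j)"
    have bl: "bounded_linear (\<lambda>X. X \<bullet> b)" by (rule bounded_linear_inner_left)
    have sum_c: "summable (\<lambda>j. c j * y ^ j)" for y
      using bounded_linear.summable[OF bl summable_matrix_exp[of y U]]
      by (simp add: c_def field_simps)
    have eq: "matrix_exp (t *\<^sub>R U) \<bullet> b = (\<Sum>j. c j * t ^ j)" for t
      using bounded_linear.suminf[OF bl summable_matrix_exp[of t U]]
      by (simp add: c_def field_simps matrix_exp_eq)
    have bl': "bounded_linear (\<lambda>X. (U ** X) \<bullet> b)"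
      by (rule bounded_linear_compose[OF bl bounded_bilinear.bounded_linear_right[OF bounded_bilinear_matrix_mult]])
    have "(U ** matrix_exp (t *\<^sub>R U)) \<bullet> b = (\<Sum>j. (U ** ((t ^ j / fact j) *\<^sub>R matrix_power U j)) \<bullet> b)"
      using bounded_linear.suminf[OF bl' summable_matrix_exp[of t U]] by (simp add: matrix_exp_eq)
    also have "\<dots> = (\<Sum>j. diffs c j * t ^ j)"
    proof (rule suminf_cong)
      fix j
      have "(U ** ((t ^ j / fact j) *\<^sub>R matrix_power U j)) \<bullet> b
          = (t ^ j / fact j) * (matrix_power U (Suc j) \<bullet> b)"
        by (simp add: matrix_power_Suc bounded_bilinear.scaleR_right[OF bounded_bilinear_matrix_mult])
      also have "\<dots> = diffs c j * t ^ j"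
        by (simp add: diffs_def c_def divide_simps del: of_nat_Suc)
      finally show "(U ** ((t ^ j / fact j) *\<^sub>R matrix_power U j)) \<bullet> b = diffs c j * t ^ j" .
    qed
    finally have "((\<lambda>t. matrix_exp (t *\<^sub>R U) \<bullet> b) has_real_derivative
        ((U ** matrix_exp (t *\<^sub>R U)) \<bullet> b)) (at t)"
      unfolding eq using termdiffs_strong_converges_everywhere[OF sum_c] by simp
    then show ?thesis
      by (simp add: has_field_derivative_def mult_commute_abs)
  qed
  then show ?thesis
    unfolding has_vector_derivative_def
    by (subst has_derivative_componentwise_within) (auto intro: has_derivative_at_withinI)
qed

lemma matrix_exp_0: "matrix_exp (0 *\<^sub>R U) = mat 1"
proof -
  have "(\<Sum>j. ((0::real) ^ j / fact j) *\<^sub>R matrix_power U j)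
      = (\<Sum>j\<in>{0}. ((0::real) ^ j / fact j) *\<^sub>R matrix_power U j)"
    by (rule suminf_finite) auto
  then show ?thesis
    unfolding matrix_exp_eq by (simp add: matrix_power_def)
qed

section \<open>Controllability\<close>

lemma inner_matrix_vector_mult: "x \<bullet> (U *v y) = (transpose U *v x) \<bullet> y"
  for U :: "real^'n^'m"
  by (simp add: dot_lmul_matrix)

text \<open>
  For \<open>w \<in> W\<close> the control does not enter the evolution of \<open>w \<bullet> \<xi>\<close>: its derivative is
  \<open>(A' w) \<bullet> \<xi>\<close> with \<open>A' w \<in> W\<close> again.  Hence the orthogonal projection of a trajectory to \<open>W\<close>
  solves a linear equation and stays at zero when it starts there, whereas controllability
  allows steering from \<open>0\<close> to \<open>v\<close>.
\<close>

lemma controllable_invariant_subspace: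
  fixes A :: "real^'n^'n" and B :: "real^'m^'n"
  assumes "controllable A B" and W: "subspace W"
    and A: "\<And>v. v \<in> W \<Longrightarrow> transpose A *v v \<in> W"
    and B: "\<And>v. v \<in> W \<Longrightarrow> transpose B *v v = 0"
    and v: "v \<in> W"
  shows "v = 0"
proof -
  have "\<exists>(T :: real) u \<xi>. 0 < T \<and> u absolutely_integrable_on {0..T} \<and>
      (\<forall>t\<in>{0..T}. ((\<lambda>s. A *v \<xi> s + B *v u s) has_integral (\<xi> t - 0)) {0..t}) \<and>
      \<xi> 0 = 0 \<and> \<xi> T = v"
    using assms(1) unfolding controllable_def by (elim allE)
  then obtain T :: real and u \<xi> where T: "0 < T"
    and \<xi>': "\<forall>t\<in>{0..T}. ((\<lambda>s. A *v \<xi> s + B *v u s) has_integral (\<xi> t - 0)) {0..t}"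
    and \<xi>0: "\<xi> 0 = 0" and \<xi>T: "\<xi> T = v"
    by (elim exE conjE)
  have \<xi>: "((\<lambda>s. A *v \<xi> s + B *v u s) has_integral \<xi> t) {0..t}" if "t \<in> {0..T}" for t
    using bspec[OF \<xi>' that] by simp
  \<comment> \<open>\<open>\<xi>\<close> is only an indefinite integral; the components along \<open>W\<close> turn out to be differentiable
    because their integrands do not contain the control.\<close>
  have cont: "continuous_on {0..T} \<xi>"
  proof -
    have "continuous_on {0..T} (\<lambda>t. integral {0..t} (\<lambda>s. A *v \<xi> s + B *v u s))"
      using \<xi>[of T] T by (intro indefinite_integral_continuous_1) (auto simp: integrable_on_def)
    then show ?thesis
      using \<xi> by (metis (mono_tags, lifting) continuous_on_cong integral_unique)
  qed
  have deriv: "((\<lambda>t. w \<bullet> \<xi> t) has_vector_derivative (transpose A *v w) \<bullet> \<xi> t) (at t within {0..T})"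
    if w: "w \<in> W" and t: "t \<in> {0..T}" for w t
  proof -
    have "w \<bullet> \<xi> s = integral {0..s} (\<lambda>s. (transpose A *v w) \<bullet> \<xi> s)" if "s \<in> {0..T}" for s
    proof -
      have "w \<bullet> (A *v \<xi> r + B *v u r) = (transpose A *v w) \<bullet> \<xi> r" for r
        using B[OF w] unfolding inner_add_right inner_matrix_vector_mult by simp
      then have "((\<lambda>r. (transpose A *v w) \<bullet> \<xi> r) has_integral w \<bullet> \<xi> s) {0..s}"
        using has_integral_linear[OF \<xi>[OF that] bounded_linear_inner_right[of w]]
        unfolding o_def by simp
      then show ?thesis by (rule integral_unique[symmetric])
    qed
    moreover have "((\<lambda>s. integral {0..s} (\<lambda>s. (transpose A *v w) \<bullet> \<xi> s))
        has_vector_derivative (transpose A *v w) \<bullet> \<xi> t) (at t within {0..T})"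
      by (intro integral_has_vector_derivative[OF _ t] continuous_on_inner continuous_on_const cont)
    ultimately show ?thesis
      by (rule has_vector_derivative_transform[OF t])
  qed
  \<comment> \<open>\<open>\<eta>\<close> is the orthogonal projection of \<open>\<xi>\<close> to \<open>W\<close>, written in an orthonormal basis.\<close>
  obtain E where E: "pairwise orthogonal E" "\<And>b. b \<in> E \<Longrightarrow> norm b = 1" "E \<subseteq> W" "span E = W"
      "independent E"
    using orthonormal_basis_subspace[OF W] by metis
  have "finite E" using E(5) independent_imp_finite by blast
  define \<eta> where "\<eta> = (\<lambda>t. \<Sum>b\<in>E. (b \<bullet> \<xi> t) *\<^sub>R b)"
  have \<eta>: "w \<bullet> \<xi> t = w \<bullet> \<eta> t" if "w \<in> W" for w t
  proof -
    have "w = (\<Sum>b\<in>E. (w \<bullet> b) *\<^sub>R b)"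
      using orthonormal_basis_expand[OF E(1,2) _ \<open>finite E\<close>, of w] E(4) that by (simp only:)
    then have "w \<bullet> \<xi> t = (\<Sum>b\<in>E. (w \<bullet> b) * (b \<bullet> \<xi> t))"
      by (metis (mono_tags, lifting) inner_scaleR_left inner_sum_left sum.cong)
    then show ?thesis
      by (simp add: \<eta>_def inner_sum_right mult.commute)
  qed
  have "\<eta> T = 0"
  proof (rule eq_0_if_derivative_norm_le[where D = \<eta> and T = T and
        D' = "\<lambda>t. \<Sum>b\<in>E. ((transpose A *v b) \<bullet> \<xi> t) *\<^sub>R b" and K = "\<Sum>b\<in>E. norm (transpose A *v b)"])
    fix t assume t: "t \<in> {0..T}"
    show "(\<eta> has_vector_derivative (\<Sum>b\<in>E. ((transpose A *v b) \<bullet> \<xi> t) *\<^sub>R b)) (at t within {0..T})"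
      unfolding \<eta>_def using E(3) t
      by (intro has_vector_derivative_sum
          bounded_linear.has_vector_derivative[OF bounded_linear_scaleR_left] deriv) auto
    have "norm (\<Sum>b\<in>E. ((transpose A *v b) \<bullet> \<xi> t) *\<^sub>R b) \<le> (\<Sum>b\<in>E. norm (transpose A *v b) * norm (\<eta> t))"
    proof (rule sum_norm_le)
      fix b assume b: "b \<in> E"
      then have "(transpose A *v b) \<bullet> \<xi> t = (transpose A *v b) \<bullet> \<eta> t"
        using E(3) A \<eta> by blast
      then show "norm (((transpose A *v b) \<bullet> \<xi> t) *\<^sub>R b) \<le> norm (transpose A *v b) * norm (\<eta> t)"
        using E(2)[OF b] Cauchy_Schwarz_ineq2[of "transpose A *v b" "\<eta> t"] by simp
    qed
    then show "norm (\<Sum>b\<in>E. ((transpose A *v b) \<bullet> \<xi> t) *\<^sub>R b)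
        \<le> (\<Sum>b\<in>E. norm (transpose A *v b)) * norm (\<eta> t)"
      by (simp only: sum_distrib_right)
  qed (use T \<xi>0 in \<open>auto simp: \<eta>_def\<close>)
  then have "v \<bullet> v = 0"
    using \<eta>[OF v, of T] \<xi>T by simp
  then show ?thesis by simp
qed

section \<open>Symplectic matrices and their scattering form\<close>

text \<open>
  Equivalent to \<open>S' J S = J\<close> for the standard skew-symmetric \<open>J\<close>, written out in blocks.
\<close>

definition symplectic :: "real^('n::finite+'n)^('n+'n) \<Rightarrow> bool" where
  "symplectic S \<longleftrightarrow>
     transpose (block11 S) ** block21 S = transpose (block21 S) ** block11 S \<and>
     transpose (block12 S) ** block22 S = transpose (block22 S) ** block12 S \<and>
     transpose (block11 S) ** block22 S - transpose (block21 S) ** block12 S = mat 1"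

text \<open>
  If \<open>S\<close> maps \<open>(u\<^sub>0, v\<^sub>0)\<close> to \<open>(u\<^sub>1, v\<^sub>1)\<close> and is symplectic, this is the matrix that maps
  \<open>(u\<^sub>1, u\<^sub>0)\<close> to \<open>(v\<^sub>1, - v\<^sub>0)\<close>, that is, the Hessian of a quadratic generating function of \<open>S\<close>.
\<close>

definition scattering :: "real^('n::finite+'n)^('n+'n) \<Rightarrow> real^('n+'n)^('n+'n)" where
  "scattering S = (let \<beta> = matrix_inv (block12 S) in
     four_blocks (block22 S ** \<beta>) (- transpose \<beta>) (- \<beta>) (\<beta> ** block11 S))"

text \<open>
  The symmetry of the diagonal blocks of the scattering form, and the expression of the block
  \<open>c\<close> by the other three: multiply the symplectic relations \<open>b' d = d' b\<close> and
  \<open>d' a - b' c = 1\<close> by \<open>b\<^sup>-\<^sup>T\<close> on the left; the symmetry of \<open>a' c\<close> then gives that of \<open>a' b\<^sup>-\<^sup>T\<close>.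
\<close>

lemma symplectic_inverse_block12:
  fixes S :: "real^('n::finite+'n)^('n+'n)"
  assumes S: "symplectic S" and inv: "invertible (block12 S)"
  defines "\<beta> \<equiv> matrix_inv (block12 S)"
  shows "transpose (block22 S ** \<beta>) = block22 S ** \<beta>"
    and "transpose (\<beta> ** block11 S) = \<beta> ** block11 S"
    and "block22 S ** \<beta> ** block11 S - transpose \<beta> = block21 S"
proof -
  define a b c d where abcd: "a = block11 S" "b = block12 S" "c = block21 S" "d = block22 S"
  have ac: "transpose a ** c = transpose c ** a" and bd: "transpose b ** d = transpose d ** b"
    and ad: "transpose a ** d - transpose c ** b = mat 1"
    using S by (simp_all add: symplectic_def abcd)
  have b: "Z ** b ** \<beta> = Z" "b ** \<beta> = mat 1" "Z ** \<beta> ** b = Z" for Z :: "real^'n^'n"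
    using matrix_inv_left_right[OF inv] by (simp_all add: \<beta>_def abcd)
  have b': "transpose \<beta> ** transpose b = mat 1"
    by (simp add: matrix_transpose_mul[symmetric] b)
  have "transpose \<beta> ** (transpose b ** d) ** \<beta> = transpose \<beta> ** (transpose d ** b) ** \<beta>"
    by (simp only: bd)
  then show 1: "transpose (block22 S ** \<beta>) = block22 S ** \<beta>"
    by (simp add: matrix_mul_assoc b b' transpose_distrib abcd[symmetric])
  have "transpose d ** a - transpose b ** c = mat 1"
    using arg_cong[OF ad, of transpose] by (simp add: transpose_distrib)
  then have "transpose \<beta> ** (transpose d ** a - transpose b ** c) = transpose \<beta>"
    by simp
  then have "transpose (d ** \<beta>) ** a - c = transpose \<beta>"
    by (simp add: matrix_distrib b' transpose_distrib)
  then show 3: "block22 S ** \<beta> ** block11 S - transpose \<beta> = block21 S"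
    unfolding 1[folded abcd] abcd[symmetric] by (simp add: algebra_simps)
  have "transpose a ** transpose \<beta> = transpose a ** (d ** \<beta>) ** a - transpose a ** c"
    using 3 unfolding abcd[symmetric] by (simp add: matrix_distrib algebra_simps flip: 3[folded abcd])
  moreover have "transpose (transpose a ** c) = transpose a ** c"
    by (simp add: matrix_transpose_mul ac)
  then have "transpose (transpose a ** (d ** \<beta>) ** a - transpose a ** c)
      = transpose a ** (d ** \<beta>) ** a - transpose a ** c"
    unfolding transpose_distrib(2) matrix_transpose_mul[of "transpose a ** (d ** \<beta>)"]
      matrix_transpose_mul[of "transpose a" "d ** \<beta>"] 1[folded abcd]
    by (simp add: matrix_mul_assoc)
  ultimately show "transpose (\<beta> ** block11 S) = \<beta> ** block11 S"
    unfolding abcd[symmetric] matrix_transpose_mul by (metis matrix_transpose_mul transpose_transpose)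
qed

text \<open>
  The coefficient to be inverted is \<open>\<beta> e \<beta>'\<close>, where \<open>e\<close> is the upper right block of \<open>X ** Y\<close> and
  \<open>\<beta>\<close>, \<open>\<beta>'\<close> are the inverses of those of \<open>X\<close> and \<open>Y\<close>.  Multiplying the upper left
  block by \<open>e\<close> on the right, or the lower right one on the left, then reduces the claim to the formula for \<open>c\<close> in \<open>symplectic_inverse_block12\<close>.
\<close>

lemma circledast_scattering:
  fixes X Y :: "real^('n::finite+'n)^('n+'n)"
  assumes X: "symplectic X" "invertible (block12 X)"
    and Y: "symplectic Y" "invertible (block12 Y)"
    and XY: "invertible (block12 (X ** Y))"
  shows "scattering X \<circledast> scattering Y = scattering (X ** Y)"
proof -
  define a b c d where abcd: "a = block11 X" "b = block12 X" "c = block21 X" "d = block22 X"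
  define a' b' c' d' where abcd': "a' = block11 Y" "b' = block12 Y" "c' = block21 Y" "d' = block22 Y"
  define e where "e = block12 (X ** Y)"
  define \<beta> \<beta>' \<gamma> where inv: "\<beta> = matrix_inv b" "\<beta>' = matrix_inv b'" "\<gamma> = matrix_inv e"
  have e: "e = a ** b' + b ** d'"
    by (simp add: e_def blocks_mult abcd abcd')
  have b: "Z ** b ** \<beta> = Z" "b ** \<beta> = mat 1" "Z ** \<beta> ** b = Z" "\<beta> ** b = mat 1" for Z :: "real^'n^'n"
    using matrix_inv_left_right[OF X(2)] by (simp_all add: inv abcd)
  have b': "Z ** b' ** \<beta>' = Z" "b' ** \<beta>' = mat 1" "Z ** \<beta>' ** b' = Z" "\<beta>' ** b' = mat 1" for Z :: "real^'n^'n"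
    using matrix_inv_left_right[OF Y(2)] by (simp_all add: inv abcd')
  have g: "Z ** e ** \<gamma> = Z" "e ** \<gamma> = mat 1" "Z ** \<gamma> ** e = Z" "\<gamma> ** e = mat 1" for Z :: "real^'n^'n"
    using matrix_inv_left_right[OF XY] by (simp_all add: inv e_def)
  note sX = symplectic_inverse_block12[OF X, folded abcd inv]
  note sY = symplectic_inverse_block12[OF Y, folded abcd' inv]
  have sc: "scattering X = four_blocks (d ** \<beta>) (- transpose \<beta>) (- \<beta>) (\<beta> ** a)"
    "scattering Y = four_blocks (d' ** \<beta>') (- transpose \<beta>') (- \<beta>') (\<beta>' ** a')"
    by (simp_all add: scattering_def Let_def abcd abcd' inv)
  have scXY: "scattering (X ** Y) = four_blocks ((c ** b' + d ** d') ** \<gamma>) (- transpose \<gamma>) (- \<gamma>)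
      (\<gamma> ** (a ** a' + b ** c'))"
    by (simp add: scattering_def e_def[symmetric] inv(3)[symmetric] Let_def)
       (simp add: blocks_mult abcd abcd')
  define P where "P = b' ** \<gamma> ** b"
  have sum: "d' ** \<beta>' + \<beta> ** a = \<beta> ** e ** \<beta>'"
    by (simp add: e matrix_distrib b b' add.commute)
  have "(d' ** \<beta>' + \<beta> ** a) ** P = mat 1"
    unfolding sum P_def by (simp add: matrix_mul_assoc b b' g)
  then have invP: "invertible (d' ** \<beta>' + \<beta> ** a)" "matrix_inv (d' ** \<beta>' + \<beta> ** a) = P"
    by (simp_all add: matrix_inv_eqI)
  then have pinv: "pseudo_inverse (d' ** \<beta>' + \<beta> ** a) = P"
    by (simp add: pseudo_inverse_invertible)
  have P_sym: "transpose P = P"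
    using symmetric_matrix_inv[OF invP(1)] by (simp add: invP(2) transpose_distrib(1) sX sY)
  have n21: "\<beta>' ** P ** \<beta> = \<gamma>"
    by (simp add: P_def matrix_mul_assoc b b')
  have n12: "transpose \<beta> ** P ** transpose \<beta>' = transpose \<gamma>"
    unfolding n21[symmetric] by (simp add: matrix_transpose_mul P_sym matrix_mul_assoc)
  have n11: "d ** \<beta> - transpose \<beta> ** P ** \<beta> = (c ** b' + d ** d') ** \<gamma>"
  proof -
    have "(d ** \<beta> - transpose \<beta> ** P ** \<beta>) ** e = d ** \<beta> ** e - transpose \<beta> ** b'"
      by (simp add: P_def matrix_distrib b g)
    also have "\<dots> = (d ** \<beta> ** a - transpose \<beta>) ** b' + d ** d'"
      by (simp add: e matrix_distrib b algebra_simps)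
    also have "\<dots> = c ** b' + d ** d'"
      by (simp only: sX(3))
    finally show ?thesis
      by (metis g(1))
  qed
  have n22: "\<beta>' ** a' - \<beta>' ** P ** transpose \<beta>' = \<gamma> ** (a ** a' + b ** c')"
  proof -
    have "e ** (\<beta>' ** a' - \<beta>' ** P ** transpose \<beta>') = e ** \<beta>' ** a' - b ** transpose \<beta>'"
      by (simp add: P_def matrix_distrib b' g)
    also have "\<dots> = a ** a' + b ** (d' ** \<beta>' ** a' - transpose \<beta>')"
      by (simp add: e matrix_distrib b' algebra_simps)
    also have "\<dots> = a ** a' + b ** c'"
      by (simp only: sY(3))
    finally show ?thesis
      by (metis g(4) matrix_mul_assoc matrix_mul_lid)
  qed
  show ?thesis
    unfolding circledast_def sc scXY
    by (simp add: Let_def pinv transpose_distrib matrix_distrib n12 n11 n22 n21 P_sym)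
qed

text \<open>
  The dependence on \<open>M\<close> cancels because \<open>M - Q\<^sup>2\<^sup>2 = M U\<^sup>-\<^sup>1 b M\<close> has the inverse
  \<open>M\<^sup>-\<^sup>1 b\<^sup>-\<^sup>1 U M\<^sup>-\<^sup>1\<close>, whose factors cancel against those of \<open>Q\<^sup>1\<^sup>2 = - U\<^sup>-\<^sup>T M\<close> and
  \<open>Q\<^sup>2\<^sup>1 = - M U\<^sup>-\<^sup>1\<close>.
\<close>

lemma Pi_inv_Xi_eq_scattering:
  fixes S :: "real^('n::finite+'n)^('n+'n)"
  assumes S: "symplectic S" and inv: "invertible (block12 S)"
    and U: "invertible (block11 S + block12 S ** M)" and M: "invertible M" "transpose M = M"
    and X12: "block12 (Xi M S) = transpose (block21 (Xi M S))"
  shows "Pi_inv M (Xi M S) = scattering S"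
proof -
  define a b c d where abcd: "a = block11 S" "b = block12 S" "c = block21 S" "d = block22 S"
  define U where "U = a + b ** M"
  define N where "N = matrix_inv U"
  define \<beta> where "\<beta> = matrix_inv b"
  define P where "P = (c + d ** M) ** N"
  have b: "Z ** b ** \<beta> = Z" "b ** \<beta> = mat 1" "Z ** \<beta> ** b = Z" "\<beta> ** b = mat 1" for Z :: "real^'n^'n"
    using matrix_inv_left_right[OF inv] by (simp_all add: \<beta>_def abcd)
  have N: "Z ** U ** N = Z" "U ** N = mat 1" "Z ** N ** U = Z" "N ** U = mat 1" for Z :: "real^'n^'n"
    using matrix_inv_left_right[OF U] by (simp_all add: N_def U_def abcd)
  define M' where "M' = matrix_inv M"
  have M': "Z ** M ** M' = Z" "M ** M' = mat 1" "Z ** M' ** M = Z" "M' ** M = mat 1" for Z :: "real^'n^'n"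
    using matrix_inv_left_right[OF M(1)] by (simp_all add: M'_def)
  have Xi: "Xi M S = four_blocks P (P ** b ** M - d ** M) (- (M ** N)) (- (M ** N) ** b ** M + M)"
    by (simp add: Xi_def Let_def P_def N_def U_def abcd)
  have X12': "P ** b ** M - d ** M = - (transpose N ** M)"
    using X12 by (simp add: Xi transpose_distrib M)
  have "(M - block22 (Xi M S)) ** (M' ** \<beta> ** U ** M') = mat 1"
    by (simp add: Xi matrix_distrib M' b N)
  then have R: "matrix_inv (M - block22 (Xi M S)) = M' ** \<beta> ** U ** M'"
    by (simp add: matrix_inv_eqI)
  have r21: "M ** (M' ** \<beta> ** U ** M') ** (- (M ** N)) = - \<beta>"
    by (simp add: matrix_distrib M' b N)
  have r22: "M ** (M' ** \<beta> ** U ** M') ** M - M = \<beta> ** a"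
  proof -
    have "M ** (M' ** \<beta> ** U ** M') ** M = \<beta> ** U" by (simp add: matrix_mul_assoc M')
    then show ?thesis by (simp add: U_def matrix_distrib b)
  qed
  have d: "d = P ** b + transpose N"
  proof -
    have "P ** b - d = (P ** b ** M - d ** M) ** M'" by (simp add: matrix_distrib M')
    also have "\<dots> = - transpose N" by (simp add: X12' matrix_distrib M')
    finally show ?thesis by (simp add: algebra_simps)
  qed
  have r11: "P + - (transpose N ** M) ** (M' ** \<beta> ** U ** M') ** (- (M ** N)) = d ** \<beta>"
    by (simp add: d matrix_distrib M' N b)
  have sym: "transpose (\<beta> ** a) = \<beta> ** a"
    unfolding abcd \<beta>_def by (rule symplectic_inverse_block12[OF S inv])
  have Usym: "transpose (\<beta> ** U) = \<beta> ** U"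
    using sym by (simp add: U_def matrix_distrib b transpose_distrib(1) M)
  have r12: "- (transpose N ** M) ** (M' ** \<beta> ** U ** M') ** M = - transpose \<beta>"
  proof -
    have "- (transpose N ** M) ** (M' ** \<beta> ** U ** M') ** M = - (transpose N ** (\<beta> ** U))"
      by (simp add: matrix_distrib M')
    also have "transpose N ** (\<beta> ** U) = transpose ((\<beta> ** U) ** N)"
      unfolding matrix_transpose_mul[of "\<beta> ** U" N] Usym ..
    finally show ?thesis by (simp add: N)
  qed
  have t12: "transpose (- (transpose N ** M)) = - (M ** N)"
    by (simp add: transpose_distrib M)
  show ?thesis
    unfolding Pi_inv_def Let_def R
    unfolding Xi blocks_four_blocks X12' t12 r11 r12 r21 r22 scattering_def Let_def
    by (simp add: \<beta>_def abcd)
qed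

lemma symmetric_scattering:
  assumes "symplectic S" "invertible (block12 S)"
  shows "symmetric_matrix (scattering S)"
  using symplectic_inverse_block12[OF assms]
  by (simp add: symmetric_matrix_def scattering_def Let_def transpose_four_blocks transpose_distrib(3))

section \<open>The Hamiltonian flow\<close>

lemma Sig_has_vector_derivative:
  "(Sig A B C has_vector_derivative hamiltonian A B C ** Sig A B C t) (at t within S)"
  unfolding Sig_def[abs_def] by (rule matrix_exp_has_vector_derivative)

lemma Sig_0: "Sig A B C 0 = mat 1"
  unfolding Sig_def by (rule matrix_exp_0)

text \<open>
  Both sides solve the same linear equation in \<open>t\<close> and agree at \<open>t = 0\<close>.
\<close>

lemma Sig_add:
  assumes "t \<ge> 0"
  shows "Sig A B C (t + s) = Sig A B C t ** Sig A B C s"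
proof -
  define D where "D = (\<lambda>r. Sig A B C (r + s) - Sig A B C r ** Sig A B C s)"
  have "D t = 0"
  proof (rule linear_matrix_ode_eq_0[where T = t and F = "\<lambda>_. hamiltonian A B C" and L = "\<lambda>_. 0"])
    fix r
    have "((\<lambda>r. Sig A B C (r + s)) has_vector_derivative hamiltonian A B C ** Sig A B C (r + s))
        (at r within {0..t})"
      using vector_diff_chain_within[of "\<lambda>r. r + s" 1 r "{0..t}" "Sig A B C"
          "hamiltonian A B C ** Sig A B C (r + s)"]
        Sig_has_vector_derivative[of A B C "r + s" "(\<lambda>r. r + s) ` {0..t}"]
      by (simp add: o_def has_vector_derivative_add_const)
    moreover have "((\<lambda>r. Sig A B C r ** Sig A B C s) has_vector_derivative
        hamiltonian A B C ** (Sig A B C r ** Sig A B C s)) (at r within {0..t})"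
      using has_vector_derivative_matrix_mult[OF Sig_has_vector_derivative[of A B C r "{0..t}"]
          has_vector_derivative_const[of "Sig A B C s"]]
      by (simp add: matrix_mul_assoc)
    ultimately show "(D has_vector_derivative hamiltonian A B C ** D r + D r ** 0) (at r within {0..t})"
      unfolding D_def by (auto simp: matrix_distrib intro: has_vector_derivative_diff)
  qed (use assms in \<open>auto simp: D_def Sig_0\<close>)
  then show ?thesis by (simp add: D_def)
qed

text \<open>
  Solutions with \<open>k\<close> columns, so that the two block columns of \<open>Sig\<close> and their combinations with
  matrix coefficients are covered at once.
\<close>

definition hamiltonian_solution ::
  "real^'n^'n \<Rightarrow> real^'m^'n \<Rightarrow> real^'n^'p \<Rightarrow> (real \<Rightarrow> real^'k^'n) \<Rightarrow> (real \<Rightarrow> real^'k^'n) \<Rightarrow> bool" where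
  "hamiltonian_solution A B C u v \<longleftrightarrow> (\<forall>t.
     (u has_vector_derivative - (A ** u t) - B ** transpose B ** v t) (at t) \<and>
     (v has_vector_derivative transpose C ** C ** u t + transpose A ** v t) (at t))"

lemma hamiltonian_solution_blocks:
  "hamiltonian_solution A B C (\<lambda>t. block11 (Sig A B C t)) (\<lambda>t. block21 (Sig A B C t))"
  "hamiltonian_solution A B C (\<lambda>t. block12 (Sig A B C t)) (\<lambda>t. block22 (Sig A B C t))"
  using bounded_linear_blocks[THEN bounded_linear.has_vector_derivative, OF Sig_has_vector_derivative[of A B C _ UNIV]]
  by (simp_all add: hamiltonian_solution_def blocks_mult hamiltonian_def matrix_distrib)

lemma hamiltonian_solution_combine:
  assumes "hamiltonian_solution A B C u v" "hamiltonian_solution A B C w z"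
  shows "hamiltonian_solution A B C (\<lambda>t. u t + w t ** X) (\<lambda>t. v t + z t ** X)"
  unfolding hamiltonian_solution_def
proof (intro allI conjI)
  fix t
  note d = assms[unfolded hamiltonian_solution_def, rule_format, of t]
  note dw = has_vector_derivative_matrix_mult[OF conjunct1[OF d(2)] has_vector_derivative_const[of X]]
  note dz = has_vector_derivative_matrix_mult[OF conjunct2[OF d(2)] has_vector_derivative_const[of X]]
  show "((\<lambda>t. u t + w t ** X) has_vector_derivative
      - (A ** (u t + w t ** X)) - B ** transpose B ** (v t + z t ** X)) (at t)"
    by (rule has_vector_derivative_eq_rhs[OF has_vector_derivative_add[OF conjunct1[OF d(1)] dw]])
      (simp add: matrix_distrib)
  show "((\<lambda>t. v t + z t ** X) has_vector_derivative
      transpose C ** C ** (u t + w t ** X) + transpose A ** (v t + z t ** X)) (at t)"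
    by (rule has_vector_derivative_eq_rhs[OF has_vector_derivative_add[OF conjunct2[OF d(1)] dz]])
      (simp add: matrix_distrib)
qed

text \<open>
  The symplectic form is invariant because the Hamiltonian matrix is infinitesimally symplectic;
  in the derivative all eight terms cancel in pairs.  Evaluated at the initial values, this
  yields all algebraic identities for the flow.
\<close>

lemma hamiltonian_wronskian_const:
  assumes "hamiltonian_solution A B C u v" "hamiltonian_solution A B C w z"
  shows "transpose (u t) ** z t - transpose (v t) ** w t = transpose (u 0) ** z 0 - transpose (v 0) ** w 0"
proof -
  define f where "f = (\<lambda>t. transpose (u t) ** z t - transpose (v t) ** w t)"
  have "(f has_vector_derivative 0) (at t)" for t
  proof -
    note d = assms[unfolded hamiltonian_solution_def, rule_format, of t]
    show ?thesis
      unfolding f_def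
      by (rule has_vector_derivative_eq_rhs[OF has_vector_derivative_diff[OF
            has_vector_derivative_matrix_mult[OF
              has_vector_derivative_transpose[OF conjunct1[OF d(1)]] conjunct2[OF d(2)]]
            has_vector_derivative_matrix_mult[OF
              has_vector_derivative_transpose[OF conjunct2[OF d(1)]] conjunct1[OF d(2)]]]])
        (simp add: transpose_distrib matrix_distrib)
  qed
  then obtain c where "\<And>t. f t = c"
    using has_vector_derivative_zero_constant[of UNIV f] by auto
  then show ?thesis
    unfolding f_def by metis
qed

lemma symplectic_Sig: "symplectic (Sig A B C t)"
  unfolding symplectic_def
  using hamiltonian_wronskian_const[OF hamiltonian_solution_blocks(1) hamiltonian_solution_blocks(1), of A B C t]
    hamiltonian_wronskian_const[OF hamiltonian_solution_blocks(2) hamiltonian_solution_blocks(2), of A B C t]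
    hamiltonian_wronskian_const[OF hamiltonian_solution_blocks(1) hamiltonian_solution_blocks(2), of A B C t]
  by (simp add: Sig_0 blocks_mat_1)

section \<open>Solutions of the Riccati equation\<close>

lemma riccati_rhs_four_blocks:
  fixes A :: "real^'n^'n" and B :: "real^'m^'n" and C :: "real^'n^'p"
    and P11 P12 P21 P22 :: "real^'n^'n"
  defines "Q \<equiv> four_blocks P11 P12 P21 P22"
    and "Ah \<equiv> four_blocks A 0 0 0 :: real ^ ('n + 'n) ^ ('n + 'n)"
    and "Bh \<equiv> col_join B 0 :: real ^ 'm ^ ('n + 'n)"
    and "Ch \<equiv> row_join C 0 :: real ^ ('n + 'n) ^ 'p"
  shows "transpose Ah ** Q + Q ** Ah + Q ** Bh ** transpose Bh ** Q + transpose Ch ** Ch =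
    four_blocks
      (transpose A ** P11 + P11 ** A + P11 ** B ** transpose B ** P11 + transpose C ** C)
      (transpose A ** P12 + P11 ** B ** transpose B ** P12)
      (P21 ** A + P21 ** B ** transpose B ** P11)
      (P21 ** B ** transpose B ** P12)"
proof -
  have "Q ** Bh ** transpose Bh ** Q = Q ** (Bh ** transpose Bh) ** Q"
    by (simp add: matrix_mul_assoc)
  then show ?thesis
    unfolding Q_def Ah_def Bh_def Ch_def row_col_join_mult
    by (simp add: transpose_four_blocks four_blocks_mult four_blocks_add matrix_mul_assoc row_col_join_mult)
qed

text \<open>
  The difference \<open>D = Q - R\<close> satisfies \<open>D' = (Ah' + R E) D + D (Ah + E Q)\<close> for \<open>E = Bh Bh'\<close>, a
  linear equation with continuous coefficients.
\<close>

lemma riccati_solution_unique: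
  assumes Q: "riccati_solution A B C M Q" and R: "riccati_solution A B C M R" and "t \<ge> 0"
  shows "Q t = R t"
proof -
  define Ah :: "real ^ ('a + 'a) ^ ('a + 'a)" where "Ah = four_blocks A 0 0 0"
  define Bh :: "real ^ 'b ^ ('a + 'a)" where "Bh = col_join B 0"
  define Ch :: "real ^ ('a + 'a) ^ 'c" where "Ch = row_join C 0"
  define E where "E = Bh ** transpose Bh"
  have deriv: "(S has_vector_derivative transpose Ah ** S r + S r ** Ah + S r ** E ** S r + transpose Ch ** Ch)
      (at r within {0..t})" if "riccati_solution A B C M S" "r \<in> {0..t}" for S r
    using that unfolding riccati_solution_def Let_def Ah_def[symmetric] Bh_def[symmetric] Ch_def[symmetric]
    by (auto simp: E_def matrix_mul_assoc intro: has_vector_derivative_within_subset)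
  have cont: "continuous_on {0..t} S" if "riccati_solution A B C M S" for S
    by (rule continuous_on_vector_derivative[OF deriv[OF that]])
  have "Q t - R t = 0"
  proof (rule linear_matrix_ode_eq_0[where T = t and D = "\<lambda>t. Q t - R t" and
        F = "\<lambda>r. transpose Ah + R r ** E" and L = "\<lambda>r. Ah + E ** Q r"])
    fix r assume r: "r \<in> {0..t}"
    show "((\<lambda>t. Q t - R t) has_vector_derivative
        (transpose Ah + R r ** E) ** (Q r - R r) + (Q r - R r) ** (Ah + E ** Q r)) (at r within {0..t})"
      by (rule has_vector_derivative_eq_rhs[OF has_vector_derivative_diff[OF deriv[OF Q r] deriv[OF R r]]])
        (simp add: matrix_distrib)
  next
    show "continuous_on {0..t} (\<lambda>r. transpose Ah + R r ** E)"
      by (intro continuous_on_add continuous_on_const cont[OF R]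
          bounded_bilinear.continuous_on[OF bounded_bilinear_matrix_mult])
    show "continuous_on {0..t} (\<lambda>r. Ah + E ** Q r)"
      by (intro continuous_on_add continuous_on_const cont[OF Q]
          bounded_bilinear.continuous_on[OF bounded_bilinear_matrix_mult])
  qed (use assms in \<open>auto simp: riccati_solution_def Let_def\<close>)
  then show ?thesis by simp
qed

text \<open>
  \<open>(U, V)\<close> is the solution of the Hamiltonian system starting at \<open>(1, M)\<close>, and \<open>P = V U\<^sup>-\<^sup>1\<close> is the
  solution of the \<open>n \<times> n\<close> Riccati equation starting at \<open>M\<close>.
  \<open>X12\<close>, \<open>X21\<close> and \<open>X22\<close> are the remaining blocks of \<open>Q\<close>.
\<close>

locale riccati_flow =
  fixes A M :: "real ^ 'n ^ 'n"
    and B :: "real ^ 'm ^ 'n"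
    and C :: "real ^ 'n ^ 'p"
  assumes transpose_M: "transpose M = M" and invertible_M: "invertible M"
    and invertible_flow: "t \<ge> 0 \<Longrightarrow> invertible (block11 (Sig A B C t) + block12 (Sig A B C t) ** M)"
begin

definition U where "U t = block11 (Sig A B C t) + block12 (Sig A B C t) ** M"
definition V where "V t = block21 (Sig A B C t) + block22 (Sig A B C t) ** M"
definition N where "N t = matrix_inv (U t)"
definition P where "P t = V t ** N t"
definition X12 where "X12 t = P t ** block12 (Sig A B C t) ** M - block22 (Sig A B C t) ** M"
definition X21 where "X21 t = - (M ** N t)"
definition X22 where "X22 t = X21 t ** block12 (Sig A B C t) ** M + M"

lemma Xi_Sig: "Xi M (Sig A B C t) = four_blocks (P t) (X12 t) (X21 t) (X22 t)"
  by (simp add: Xi_def Let_def P_def X12_def X21_def X22_def N_def U_def V_def)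

lemma UN:
  assumes "t \<ge> 0"
  shows "U t ** N t = mat 1" "N t ** U t = mat 1" "Z ** U t ** N t = Z" "Z ** N t ** U t = Z"
  using matrix_inv_left_right[OF invertible_flow[OF assms]] by (simp_all add: U_def N_def)

lemma solution_UV: "hamiltonian_solution A B C U V"
  unfolding U_def[abs_def] V_def[abs_def]
  by (intro hamiltonian_solution_combine hamiltonian_solution_blocks)

text \<open>
  By the constancy of the Wronskian of \<open>(U, V)\<close> with itself, \<open>U' V\<close> is symmetric.
\<close>

lemma transpose_P:
  assumes "t \<ge> 0"
  shows "transpose (P t) = P t"
proof -
  have UV: "transpose (U t) ** V t = transpose (V t) ** U t"
    using hamiltonian_wronskian_const[OF solution_UV solution_UV, of t]
    by (simp add: U_def V_def Sig_0 blocks_mat_1 transpose_M)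
  have NU: "transpose (N t) ** transpose (U t) = mat 1"
    by (simp add: matrix_transpose_mul[symmetric] UN[OF assms])
  have "transpose (P t) = transpose (N t) ** (transpose (V t) ** U t) ** N t"
    by (simp add: P_def matrix_mul_assoc matrix_transpose_mul UN[OF assms])
  also have "\<dots> = P t"
    unfolding UV[symmetric] by (simp add: matrix_mul_assoc NU P_def)
  finally show ?thesis .
qed

text \<open>
  The Wronskian of \<open>(U, V)\<close> and the second block column of the flow is \<open>1\<close>.
\<close>

lemma block22_Sig:
  assumes "t \<ge> 0"
  shows "block22 (Sig A B C t) = P t ** block12 (Sig A B C t) + transpose (N t)"
proof -
  let ?b = "block12 (Sig A B C t)" and ?d = "block22 (Sig A B C t)"
  have "transpose (U t) ** ?d - transpose (V t) ** ?b = mat 1"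
    using hamiltonian_wronskian_const[OF solution_UV hamiltonian_solution_blocks(2), of t]
    by (simp add: U_def V_def Sig_0 blocks_mat_1 transpose_M)
  then have *: "transpose (N t) ** (transpose (U t) ** ?d - transpose (V t) ** ?b) = transpose (N t)"
    by simp
  have NU: "transpose (N t) ** transpose (U t) = mat 1"
    by (simp add: matrix_transpose_mul[symmetric] UN[OF assms])
  have "transpose (N t) ** transpose (V t) = P t"
    using transpose_P[OF assms] by (simp add: P_def matrix_transpose_mul)
  then show ?thesis
    using * by (simp add: matrix_distrib NU algebra_simps)
qed

text \<open>
  This is where the symmetry of \<open>Q\<close> becomes visible; it also reduces the derivative of \<open>X12\<close> to
  that of \<open>X21\<close>.
\<close>

lemma X12_eq:
  assumes "t \<ge> 0"
  shows "X12 t = transpose (X21 t)"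
  by (simp add: X12_def X21_def block22_Sig[OF assms] matrix_distrib transpose_distrib transpose_M)

text \<open>
  With \<open>d = P b + U\<^sup>-\<^sup>T\<close>, the symmetry of \<open>b' d\<close> and of \<open>P\<close> makes \<open>b' U\<^sup>-\<^sup>T\<close> symmetric.
\<close>

lemma transpose_X22:
  assumes "t \<ge> 0"
  shows "transpose (X22 t) = X22 t"
proof -
  let ?b = "block12 (Sig A B C t)" and ?d = "block22 (Sig A B C t)"
  have bd: "transpose (transpose ?b ** ?d) = transpose ?b ** ?d"
    using symplectic_Sig[of A B C t] by (simp add: symplectic_def matrix_transpose_mul)
  have bPb: "transpose (transpose ?b ** P t ** ?b) = transpose ?b ** P t ** ?b"
    by (simp add: matrix_transpose_mul transpose_P[OF assms] matrix_mul_assoc)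
  have "transpose ?b ** transpose (N t) = transpose ?b ** ?d - transpose ?b ** P t ** ?b"
    by (simp add: block22_Sig[OF assms] matrix_distrib)
  then have "transpose (transpose ?b ** transpose (N t)) = transpose ?b ** transpose (N t)"
    by (simp only: transpose_distrib(2) bd bPb)
  then have "N t ** ?b = transpose ?b ** transpose (N t)"
    by (simp add: matrix_transpose_mul)
  then have Nb: "Z ** N t ** ?b = Z ** transpose ?b ** transpose (N t)" for Z :: "real^'n^'n"
    by (simp add: matrix_mul_assoc[symmetric])
  show ?thesis
    by (simp add: X22_def X21_def matrix_distrib transpose_distrib transpose_M Nb)
qed

lemma symmetric_Xi:
  assumes "t \<ge> 0"
  shows "symmetric_matrix (Xi M (Sig A B C t))"
  by (simp add: symmetric_matrix_def Xi_Sig transpose_four_blocks transpose_P transpose_X22 X12_eq assms)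

lemma deriv_N:
  assumes "t \<ge> 0"
  shows "(N has_vector_derivative N t ** A + N t ** B ** transpose B ** P t) (at t within {0..})"
proof -
  have U: "(U has_vector_derivative - (A ** U t) - B ** transpose B ** V t) (at t within {0..})"
    using solution_UV by (auto simp: hamiltonian_solution_def intro: has_vector_derivative_at_within)
  show ?thesis
    unfolding N_def[abs_def]
    by (rule has_vector_derivative_eq_rhs[OF has_vector_derivative_matrix_inv[OF U]])
      (use assms invertible_flow in \<open>auto simp: U_def[symmetric] N_def[symmetric] matrix_distrib UN P_def\<close>)
qed

lemma deriv_P:
  assumes "t \<ge> 0"
  shows "(P has_vector_derivative
    transpose A ** P t + P t ** A + P t ** B ** transpose B ** P t + transpose C ** C) (at t within {0..})"
proof -
  have V: "(V has_vector_derivative transpose C ** C ** U t + transpose A ** V t) (at t within {0..})"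
    using solution_UV by (auto simp: hamiltonian_solution_def intro: has_vector_derivative_at_within)
  show ?thesis
    unfolding P_def[abs_def]
    by (rule has_vector_derivative_eq_rhs[OF has_vector_derivative_matrix_mult[OF V deriv_N[OF assms]]])
      (simp add: matrix_distrib UN[OF assms] P_def)
qed

lemma deriv_X21:
  assumes "t \<ge> 0"
  shows "(X21 has_vector_derivative X21 t ** A + X21 t ** B ** transpose B ** P t) (at t within {0..})"
  unfolding X21_def[abs_def]
  by (rule has_vector_derivative_eq_rhs[OF has_vector_derivative_minus[OF
        has_vector_derivative_matrix_mult[OF has_vector_derivative_const[of M] deriv_N[OF assms]]]])
    (simp add: matrix_distrib)

lemma deriv_X12:
  assumes "t \<ge> 0"
  shows "(X12 has_vector_derivative transpose A ** X12 t + P t ** B ** transpose B ** X12 t) (at t within {0..})"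
proof (rule has_vector_derivative_transform[of t "{0..}"])
  show "((\<lambda>t. transpose (X21 t)) has_vector_derivative
      transpose A ** X12 t + P t ** B ** transpose B ** X12 t) (at t within {0..})"
    by (rule has_vector_derivative_eq_rhs[OF has_vector_derivative_transpose[OF deriv_X21[OF assms]]])
      (simp add: transpose_distrib transpose_P[OF assms] X12_eq[OF assms] matrix_mul_assoc)
qed (use assms X12_eq in auto)

lemma deriv_X22:
  assumes "t \<ge> 0"
  shows "(X22 has_vector_derivative X21 t ** B ** transpose B ** X12 t) (at t within {0..})"
proof -
  have b: "((\<lambda>t. block12 (Sig A B C t)) has_vector_derivative
      - (A ** block12 (Sig A B C t)) - B ** transpose B ** block22 (Sig A B C t)) (at t within {0..})"
    using hamiltonian_solution_blocks(2)[of A B C]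
    by (auto simp: hamiltonian_solution_def intro: has_vector_derivative_at_within)
  show ?thesis
    unfolding X22_def[abs_def]
    by (rule has_vector_derivative_eq_rhs[OF has_vector_derivative_add[OF
          has_vector_derivative_matrix_mult[OF
            has_vector_derivative_matrix_mult[OF deriv_X21[OF assms] b]
            has_vector_derivative_const[of M]]
          has_vector_derivative_const[of M]]])
      (simp add: matrix_distrib X12_def)
qed

lemma riccati_solution_Xi: "riccati_solution A B C M (\<lambda>t. Xi M (Sig A B C t))"
proof -
  have "N 0 = mat 1"
    using UN(1)[of 0] by (simp add: U_def Sig_0 blocks_mat_1)
  then have "Xi M (Sig A B C 0) = four_blocks M (- M) (- M) M"
    unfolding Xi_Sig by (simp add: P_def X12_def X21_def X22_def V_def Sig_0 blocks_mat_1)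
  then show ?thesis
    unfolding riccati_solution_def Let_def
  proof (intro conjI allI impI)
    fix t :: real assume t: "t \<ge> 0"
    show "symmetric_matrix (Xi M (Sig A B C t))"
      by (rule symmetric_Xi[OF t])
    show "((\<lambda>t. Xi M (Sig A B C t)) has_vector_derivative
        transpose (four_blocks A 0 0 0) ** Xi M (Sig A B C t) + Xi M (Sig A B C t) ** four_blocks A 0 0 0 +
        Xi M (Sig A B C t) ** col_join B 0 ** transpose (col_join B 0) ** Xi M (Sig A B C t) +
        transpose (row_join C 0) ** row_join C 0) (at t within {0..})"
      unfolding Xi_Sig riccati_rhs_four_blocks
      by (intro has_vector_derivative_four_blocks deriv_P deriv_X12 deriv_X21 deriv_X22 t)
  qed
qed

lemma riccati_eq_Xi:
  assumes "t \<ge> 0"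
  shows "riccati A B C M t = Xi M (Sig A B C t)"
  unfolding riccati_def
  by (rule the_equality) (use riccati_solution_Xi riccati_solution_unique assms in blast)+

text \<open>
  The quadratic form \<open>f\<close> starts at \<open>0\<close> and has derivative \<open>|B' y|\<^sup>2\<close>.  If it is not positive at \<open>t\<close>,
  it vanishes on \<open>{0..t}\<close>, so \<open>B' y = 0\<close> there.  This turns \<open>y' = (A' + P B B') y\<close> into \<open>y' = A' y\<close>,
  and differentiating \<open>B' y = 0\<close> repeatedly puts \<open>y 0 = - M x\<close> into an \<open>A'\<close>-invariant subspace
  of the kernel of \<open>B'\<close>, which is trivial by controllability.
\<close>

lemma block22_Xi_positive:
  assumes contr: "controllable A B" and t: "t > 0" and x: "x \<noteq> 0"
  shows "0 < x \<bullet> ((X22 t - M) *v x)"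
proof (rule ccontr)
  assume not_pos: "\<not> 0 < x \<bullet> ((X22 t - M) *v x)"
  define f where "f = (\<lambda>s. x \<bullet> ((X22 s - M) *v x))"
  define y where "y = (\<lambda>s. X12 s *v x)"
  have bl: "bounded_linear (\<lambda>Z. Z *v z)" for z :: "real^'n"
    by (rule bounded_bilinear.bounded_linear_left[OF bounded_bilinear_matrix_vector_mult])
  have deriv_f: "(f has_vector_derivative (transpose B *v y s) \<bullet> (transpose B *v y s)) (at s within {0..t})"
    if s: "s \<in> {0..t}" for s
  proof -
    have "(X22 has_vector_derivative X21 s ** B ** transpose B ** X12 s) (at s within {0..t})"
      using s by (intro has_vector_derivative_within_subset[OF deriv_X22]) auto
    from has_vector_derivative_diff[OF this has_vector_derivative_const[of M]]
    have "((\<lambda>s. X22 s - M) has_vector_derivative X21 s ** B ** transpose B ** X12 s) (at s within {0..t})"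
      by simp
    from bounded_linear.has_vector_derivative[OF bounded_linear_inner_right[of x]
        bounded_linear.has_vector_derivative[OF bl this]]
    have "(f has_vector_derivative x \<bullet> ((X21 s ** B ** transpose B ** X12 s) *v x)) (at s within {0..t})"
      unfolding f_def .
    moreover have "x \<bullet> ((X21 s ** B ** transpose B ** X12 s) *v x) = (transpose B *v y s) \<bullet> (transpose B *v y s)"
      using s
      by (simp add: matrix_vector_mul_assoc[symmetric] y_def inner_matrix_vector_mult X12_eq
          del: transpose_matrix_vector)
    ultimately show ?thesis by simp
  qed
  have mono: "f r \<le> f s" if "0 \<le> r" "r \<le> s" "s \<le> t" for r s
  proof (rule DERIV_nonneg_imp_increasing_open[of r s f])
    fix q assume "r < q" "q < s"
    then have "(f has_vector_derivative (transpose B *v y q) \<bullet> (transpose B *v y q)) (at q)"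
      using deriv_f[of q] that at_within_interior[of q "{0..t}"] by auto
    then show "\<exists>y. DERIV f q :> y \<and> y \<ge> 0"
      by (auto simp: has_real_derivative_iff_has_vector_derivative)
  next
    show "continuous_on {r..s} f"
      using that by (intro continuous_on_subset[OF continuous_on_vector_derivative[OF deriv_f]]) auto
  qed (use that in auto)
  have "N 0 = mat 1"
    using UN(1)[of 0] by (simp add: U_def Sig_0 blocks_mat_1)
  then have X12_0: "X12 0 = - M" and X22_0: "X22 0 = M"
    by (simp_all add: X12_eq X21_def transpose_distrib transpose_M X22_def Sig_0 blocks_mat_1)
  have f_0: "f s = 0" if "s \<in> {0..t}" for s
    using mono[of 0 s] mono[of s t] that not_pos by (simp add: f_def X22_0)
  have By: "transpose B *v y s = 0" if s: "s \<in> {0..t}" for s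
  proof -
    have "(f has_vector_derivative 0) (at s within {0..t})"
      by (rule has_vector_derivative_transform[OF s f_0 has_vector_derivative_const]) simp
    then have "(transpose B *v y s) \<bullet> (transpose B *v y s) = 0"
      by (rule vector_derivative_unique_within_closed_interval[OF t, unfolded cbox_interval, OF s deriv_f[OF s]])
    then show ?thesis by simp
  qed
  have deriv_y: "(y has_vector_derivative transpose A *v y s) (at s within {0..t})" if s: "s \<in> {0..t}" for s
  proof -
    have "(X12 has_vector_derivative transpose A ** X12 s + P s ** B ** transpose B ** X12 s) (at s within {0..t})"
      using s by (intro has_vector_derivative_within_subset[OF deriv_X12]) auto
    from bounded_linear.has_vector_derivative[OF bl[of x] this]
    show ?thesis
      using By[OF s] unfolding y_def
      by (simp add: matrix_vector_mult_add_rdistrib matrix_vector_mul_assoc[symmetric]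
          del: transpose_matrix_vector)
  qed
  \<comment> \<open>The largest subspace of the kernel of \<open>B'\<close> that is invariant under \<open>A'\<close>.\<close>
  define W where "W = {v. \<forall>k. transpose B *v (matrix_power (transpose A) k *v v) = 0}"
  have pow_comm: "matrix_power Z k ** Z = matrix_power Z (Suc k)" for Z :: "real^'n^'n" and k
    by (induction k) (simp_all add: matrix_power_def matrix_mul_assoc[symmetric])
  have "transpose B *v (matrix_power (transpose A) k *v y s) = 0" if "s \<in> {0..t}" for k s
    using that
  proof (induction k arbitrary: s)
    case 0
    then show ?case using By by (simp add: matrix_power_def del: transpose_matrix_vector)
  next
    case (Suc k)
    let ?Z = "transpose B ** matrix_power (transpose A) k"
    have "((\<lambda>s. ?Z *v y s) has_vector_derivative ?Z *v (transpose A *v y s)) (at s within {0..t})"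
      by (rule bounded_linear.has_vector_derivative[OF
            bounded_bilinear.bounded_linear_right[OF bounded_bilinear_matrix_vector_mult] deriv_y[OF Suc.prems]])
    then have "?Z *v (transpose A *v y s) = 0"
    proof (rule vector_derivative_unique_within_closed_interval[OF t, unfolded cbox_interval, OF Suc.prems])
      show "((\<lambda>s. ?Z *v y s) has_vector_derivative 0) (at s within {0..t})"
        using Suc.IH by (intro has_vector_derivative_transform[OF Suc.prems _ has_vector_derivative_const])
          (simp add: matrix_vector_mul_assoc[symmetric] del: transpose_matrix_vector)
    qed
    then show ?case
      by (simp add: pow_comm[symmetric] matrix_vector_mul_assoc matrix_mul_assoc del: transpose_matrix_vector)
  qed
  then have "y 0 \<in> W"
    using t by (simp add: W_def del: transpose_matrix_vector)
  have "y 0 = 0"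
  proof (rule controllable_invariant_subspace[OF contr _ _ _ \<open>y 0 \<in> W\<close>])
    show "subspace W"
      by (auto simp: subspace_def W_def matrix_vector_right_distrib matrix_vector_mult_scaleR
          simp del: transpose_matrix_vector)
    show "transpose A *v v \<in> W" if "v \<in> W" for v
    proof -
      have "transpose B *v (matrix_power (transpose A) k *v (transpose A *v v)) = 0" for k
        using that pow_comm[of "transpose A" k] unfolding W_def mem_Collect_eq
        by (simp add: matrix_vector_mul_assoc del: transpose_matrix_vector)
      then show ?thesis by (simp add: W_def del: transpose_matrix_vector)
    qed
    show "transpose B *v v = 0" if "v \<in> W" for v
      using that unfolding W_def mem_Collect_eq
      by (drule_tac spec[of _ 0]) (simp add: matrix_power_def del: transpose_matrix_vector)
  qed
  then have "M *v x = 0"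
    by (simp add: y_def X12_0 bounded_bilinear.minus_left[OF bounded_bilinear_matrix_vector_mult])
  then have "matrix_inv M *v (M *v x) = 0" by simp
  then show False
    using x by (simp add: matrix_vector_mul_assoc matrix_inv_works[OF invertible_M])
qed

lemma positive_definite_block22:
  assumes "controllable A B" "t > 0"
  shows "positive_definite (X22 t - M)"
  using block22_Xi_positive[OF assms] assms(2)
  by (simp add: positive_definite_def symmetric_matrix_def transpose_distrib transpose_X22 transpose_M)

text \<open>
  \<open>X22 - M = - M U\<^sup>-\<^sup>1 b M\<close> is definite, hence all its factors are invertible.
\<close>

lemma invertible_block12_Sig:
  assumes "controllable A B" "t > 0"
  shows "invertible (block12 (Sig A B C t))"
proof -
  have "invertible (X22 t - M)"
    unfolding invertible_left_inverse matrix_left_invertible_ker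
    using block22_Xi_positive[OF assms] by (metis inner_zero_right less_irrefl)
  moreover have "X22 t - M = - (M ** N t) ** block12 (Sig A B C t) ** M"
    by (simp add: X22_def X21_def)
  ultimately show ?thesis
    by (simp add: invertible_det_nz det_mul)
qed

lemma riccati_in_Pi_inv_domain:
  assumes "controllable A B" "t > 0"
  shows "riccati A B C M t \<in> Pi_inv_domain M"
  using positive_definite_block22[OF assms] symmetric_Xi[of t] assms(2)
  by (simp add: riccati_eq_Xi Pi_inv_domain_def Xi_Sig)

lemma Lam_eq_scattering:
  assumes "controllable A B" "t > 0"
  shows "Lam A B C M t = scattering (Sig A B C t)"
proof -
  have t: "t \<ge> 0" using assms(2) by simp
  show ?thesis
    unfolding Lam_def riccati_eq_Xi[OF t]
    by (rule Pi_inv_Xi_eq_scattering[OF symplectic_Sig invertible_block12_Sig[OF assms]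
          invertible_flow[OF t] invertible_M transpose_M]) (simp add: Xi_Sig X12_eq[OF t])
qed

end

section \<open>The semigroups\<close>

text \<open>
  On the range of \<open>F\<close>, associativity of \<open>f\<close> is that of addition.
\<close>

lemma one_parameter_semigroupI:
  assumes "\<And>t s. t > 0 \<Longrightarrow> s > 0 \<Longrightarrow> F (t + s) = f (F t) (F s)"
  shows "one_parameter_semigroup f F"
  unfolding one_parameter_semigroup_def
  by (auto simp: assms[symmetric] add.assoc)

lemma invertible_flow_of_escape_time:
  assumes "escape_time A B C M = \<infinity>" "t \<ge> 0"
  shows "invertible (block11 (Sig A B C t) + block12 (Sig A B C t) ** M)"
proof (cases "t = 0")
  case True
  then show ?thesis by (auto simp: Sig_0 blocks_mat_1 intro: matrix_inv_eqI(1)[of _ "mat 1"])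
next
  case False
  then have "ereal t < escape_time A B C M" using assms by simp
  then show ?thesis
    using False assms(2) unfolding escape_time_def less_Sup_iff by auto
qed

theorem mainTheorem3:
  fixes A M :: "real ^ 'n ^ 'n"
    and B :: "real ^ 'm ^ 'n"
    and C :: "real ^ 'n ^ 'p"
  assumes "symmetric_matrix M"
    and "invertible M"
    and "escape_time A B C M = \<infinity>"
    and "controllable A B"
  shows "(\<forall>t>0. Sig A B C t \<in> Xi_domain M \<and>
                Xi M (Sig A B C t) \<in> Pi_inv_domain M \<and>
                riccati A B C M t \<in> Pi_inv_domain M \<and>
                symmetric_matrix (Lam A B C M t) \<and>
                Lam A B C M t = Pi_inv M (Xi M (Sig A B C t))) \<and>
         one_parameter_semigroup (**) (Sig A B C) \<and>
         one_parameter_semigroup (\<circledast>) (Lam A B C M)"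
proof (intro conjI allI impI)
  interpret riccati_flow A M B C
    by unfold_locales
      (use assms invertible_flow_of_escape_time in \<open>auto simp: symmetric_matrix_def\<close>)
  note contr = assms(4)
  fix t :: real assume t: "t > 0"
  show "Sig A B C t \<in> Xi_domain M"
    using invertible_flow[of t] t by (simp add: Xi_domain_def)
  show "riccati A B C M t \<in> Pi_inv_domain M"
    by (rule riccati_in_Pi_inv_domain[OF contr t])
  then show "Xi M (Sig A B C t) \<in> Pi_inv_domain M"
    using riccati_eq_Xi[of t] t by simp
  show "symmetric_matrix (Lam A B C M t)"
    unfolding Lam_eq_scattering[OF contr t]
    by (rule symmetric_scattering[OF symplectic_Sig invertible_block12_Sig[OF contr t]])
  show "Lam A B C M t = Pi_inv M (Xi M (Sig A B C t))"
    using riccati_eq_Xi[of t] t by (simp add: Lam_def)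
next
  show "one_parameter_semigroup (**) (Sig A B C)"
    by (intro one_parameter_semigroupI Sig_add) simp
next
  interpret riccati_flow A M B C
    by unfold_locales
      (use assms invertible_flow_of_escape_time in \<open>auto simp: symmetric_matrix_def\<close>)
  note contr = assms(4)
  show "one_parameter_semigroup (\<circledast>) (Lam A B C M)"
  proof (rule one_parameter_semigroupI)
    fix t s :: real assume "t > 0" "s > 0"
    then show "Lam A B C M (t + s) = Lam A B C M t \<circledast> Lam A B C M s"
      using circledast_scattering[OF symplectic_Sig invertible_block12_Sig[OF contr]
          symplectic_Sig invertible_block12_Sig[OF contr], of t s]
        invertible_block12_Sig[OF contr, of "t + s"]
      by (simp add: Lam_eq_scattering[OF contr] Sig_add)
  qed
qed

end
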